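(* Given an input $u\in\{0,1\}^{N\times\mathcal{O}(\log c)}$ to MQAR (where distinct tokens of the vocabulary, of size $c$, are assumed to be embedded into distinct vectors in $\{0,1\}^{\mathcal{O}(\log c)}$), there exists a BaseConv operator (with data-independent convolution filters, i.e. filters that are parameters of the model and do not depend on the input) that solves MQAR for $u$ using $\tilde{\mathcal{O}}(N\log c)$ parameters, $\tilde{\mathcal{O}}(N\log c)$ time complexity and $\tilde{\mathcal{O}}(1)$ layers.
   Context: $\tilde{\mathcal{O}}(\cdot)$ hides poly-logarithmic factors. MQAR. The input is a sequence $x_0,\dots,x_{N-1}$ of tokens drawn from a vocabulary $C$ of size $c=|C|$; row $i$ of $u$ is the embedding $u_i$ of $x_i$. The task is to check, for every query $1\le i<N$, whether there exists $0\le j<i$ such that $u_i\equiv u_j$, and if so, output $u_{j+1}$ (at position $i$). Kaleidoscope matrices. For $k\ge 2$ a power of 2, a butterfly factor of size $k$ is a matrix $\begin{bmatrix} D_1 & D_2 \\ D_3 & D_4 \end{bmatrix}$ with each $D_i$ a $\frac k2\times\frac k2$ diagonal matrix. A butterfly factor matrix $B^{(n)}_k$ is an $n\times n$ block diagonal matrix of $n/k$ (possibly different) butterfly factors of size $k$. A butterfly matrix of size $n$ is a product $B^{(n)}=B^{(n)}_nB^{(n)}_{n/2}\cdots B^{(n)}_2$. Let $\mathcal{B}$ be the set of butterfly matrices; $(\mathcal{B}\mathcal{B}^* )$ the set of matrices $M_1M_2^*$ with $M_1,M_2\in\mathcal{B}$; $(\mathcal{B}\mathcal{B}^* )^{w}$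 the set of products of $w$ matrices from $(\mathcal{B}\mathcal{B}^* )$; and $(\mathcal{B}\mathcal{B}^* )^{w}_{e}$ the set of $n\times n$ matrices $SES^\top$ with $E\in(\mathcal{B}\mathcal{B}^* )^{w}$ of size $en\times en$ and $S=[I_n\ 0\ \cdots\ 0]\in\mathbb{R}^{n\times en}$. BaseConv. A BaseConv layer maps $u\in\mathbb{R}^{N'\times d'}$ to $(uW+b_1)\odot(h\ast u+b_2)$, where $W\in\mathbb{R}^{d'\times d'}$ belongs to $(\mathcal{B}\mathcal{B}^* )^{\mathrm{poly}\log d'}_{\mathrm{poly}\log d'}$, $h,b_1,b_2\in\mathbb{R}^{N'\times d'}$, $\odot$ is the entrywise product, and $h\ast u$ is the column-wise convolution (product of the polynomials whose coefficients are the columns, taken modulo $X^{N'}$; circular convolution, modulo $X^{N'}-1$, is also allowed). A BaseConv operator on inputs in $\mathbb{R}^{N\times d}$ is a stack of such layers (each with its own parameters) of some inner dimension $(N',d')$: the input is embedded as the top-left block of an otherwise zero $N'\times d'$ matrix, and the output is the top-left $N\times d$ block of the last layer's output. All parameters are independent of the input. *)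

theory Defs
  imports
    "Jordan_Normal_Form.Matrix"
    "HOL-Library.Discrete_Functions"
    "HOL-Computational_Algebra.Polynomial"
begin

section \<open>Kaleidoscope matrices\<close>

text \<open>All matrices are real, so the adjoint is the transpose.\<close>

definition mat_prod :: "nat \<Rightarrow> real mat list \<Rightarrow> real mat" where
  "mat_prod n Ms = foldr (*) Ms (1\<^sub>m n)"

definition butterfly_factors :: "nat \<Rightarrow> real mat set" where
  "butterfly_factors k = {four_block_mat D1 D2 D3 D4 | D1 D2 D3 D4.
     \<forall>D\<in>{D1, D2, D3, D4}. D \<in> carrier_mat (k div 2) (k div 2) \<and> diagonal_mat D}"

definition butterfly_factor_matrices :: "nat \<Rightarrow> nat \<Rightarrow> real mat set" where
  "butterfly_factor_matrices n k = {diag_block_mat Fs | Fs.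
     length Fs = n div k \<and> set Fs \<subseteq> butterfly_factors k}"

text \<open>Products \<open>B\<^sub>n B\<^sub>n\<^sub>/\<^sub>2 \<cdots> B\<^sub>2\<close>; the set is empty unless \<open>n\<close> is a power of 2.\<close>

definition butterfly_matrices :: "nat \<Rightarrow> real mat set" where
  "butterfly_matrices n = {mat_prod n (map B (rev [1..<Suc m])) | m B.
     n = 2 ^ m \<and> (\<forall>i\<in>{1..m}. B i \<in> butterfly_factor_matrices n (2 ^ i))}"

definition BBstar :: "nat \<Rightarrow> real mat set" where
  "BBstar n = {M1 * transpose_mat M2 | M1 M2.
     M1 \<in> butterfly_matrices n \<and> M2 \<in> butterfly_matrices n}"

definition BBstar_power :: "nat \<Rightarrow> nat \<Rightarrow> real mat set" where
  "BBstar_power w n = {mat_prod n Ms | Ms. 1 \<le> w \<and> length Ms = w \<and> set Ms \<subseteq> BBstar n}"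

definition selection_mat :: "nat \<Rightarrow> nat \<Rightarrow> real mat" where
  "selection_mat n m = mat n m (\<lambda>(i, j). if i = j then 1 else 0)"

definition kaleidoscope :: "nat \<Rightarrow> nat \<Rightarrow> nat \<Rightarrow> real mat set" where
  "kaleidoscope w e n =
     {selection_mat n (e * n) * E * transpose_mat (selection_mat n (e * n)) | E.
        E \<in> BBstar_power w (e * n)}"


section \<open>BaseConv\<close>

datatype conv_kind = Linear | Circular

fun conv_modulus :: "conv_kind \<Rightarrow> nat \<Rightarrow> real poly" where
  "conv_modulus Linear n = monom 1 n"
| "conv_modulus Circular n = monom 1 n - 1"

definition col_poly :: "real mat \<Rightarrow> nat \<Rightarrow> real poly" where
  "col_poly M j = Poly (list_of_vec (col M j))"

definition conv :: "conv_kind \<Rightarrow> real mat \<Rightarrow> real mat \<Rightarrow> real mat" where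
  "conv t h u = mat (dim_row u) (dim_col u) (\<lambda>(i, j).
     coeff ((col_poly h j * col_poly u j) mod conv_modulus t (dim_row u)) i)"

definition hadamard :: "real mat \<Rightarrow> real mat \<Rightarrow> real mat" where
  "hadamard A B = mat (dim_row A) (dim_col A) (\<lambda>ij. A $$ ij * B $$ ij)"

text \<open>The fields \<open>width\<close> and \<open>expansion\<close> record the class
  \<open>(\<B>\<B>\<^sup>*)\<^sup>w\<^sub>e\<close> through which \<open>weight\<close> is parametrised.\<close>

record layer =
  width :: nat
  expansion :: nat
  weight :: "real mat"
  filter_mat :: "real mat"
  bias1 :: "real mat"
  bias2 :: "real mat"
  kind :: conv_kind

definition layer_wf :: "nat \<Rightarrow> nat \<Rightarrow> layer \<Rightarrow> bool" where
  "layer_wf n d L \<longleftrightarrow>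
     weight L \<in> kaleidoscope (width L) (expansion L) d \<and>
     filter_mat L \<in> carrier_mat n d \<and> bias1 L \<in> carrier_mat n d \<and> bias2 L \<in> carrier_mat n d"

definition layer_apply :: "layer \<Rightarrow> real mat \<Rightarrow> real mat" where
  "layer_apply L u =
     hadamard (u * weight L + bias1 L) (conv (kind L) (filter_mat L) u + bias2 L)"

record baseconv =
  inner_rows :: nat
  inner_cols :: nat
  layers :: "layer list"

text \<open>Restricts or zero-pads a matrix to shape \<open>n \<times> d\<close>, keeping the top-left corner fixed.\<close>

definition resize :: "nat \<Rightarrow> nat \<Rightarrow> real mat \<Rightarrow> real mat" where
  "resize n d M = mat n d (\<lambda>(i, j). if i < dim_row M \<and> j < dim_col M then M $$ (i, j) else 0)"

definition baseconv_wf :: "nat \<Rightarrow> nat \<Rightarrow> baseconv \<Rightarrow> bool" where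
  "baseconv_wf N d T \<longleftrightarrow> N \<le> inner_rows T \<and> d \<le> inner_cols T \<and>
     (\<forall>L\<in>set (layers T). layer_wf (inner_rows T) (inner_cols T) L)"

text \<open>The head of the list of layers is applied first.\<close>

definition baseconv_apply :: "baseconv \<Rightarrow> real mat \<Rightarrow> real mat" where
  "baseconv_apply T u = resize (dim_row u) (dim_col u)
     (fold layer_apply (layers T) (resize (inner_rows T) (inner_cols T) u))"

text \<open>A butterfly matrix of size \<open>n\<close> has \<open>log\<^sub>2 n\<close> factors \<open>B\<^sub>k\<close>, each with \<open>n / k\<close> blocks of
  four diagonals of length \<open>k / 2\<close>. An element of \<open>(\<B>\<B>\<^sup>*)\<^sup>w\<^sub>e\<close> uses \<open>2 w\<close> butterfly
  matrices of size \<open>e n\<close>.\<close>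

definition butterfly_params :: "nat \<Rightarrow> nat" where
  "butterfly_params n = 2 * n * floor_log n"

definition layer_params :: "nat \<Rightarrow> nat \<Rightarrow> layer \<Rightarrow> nat" where
  "layer_params n d L = 2 * width L * butterfly_params (expansion L * d) + 3 * (n * d)"

definition baseconv_params :: "baseconv \<Rightarrow> nat" where
  "baseconv_params T = (\<Sum>L\<leftarrow>layers T. layer_params (inner_rows T) (inner_cols T) L)"


section \<open>Time complexity\<close>

text \<open>Time is the number of arithmetic operations over the reals, loading a constant (in
  particular, a parameter of the model) included. A program starts from a memory holding the
  entries of the input row by row; every instruction appends one value to the memory.\<close>

datatype instr = Load real | Add nat nat | Sub nat nat | Mul nat nat

fun instr_value :: "real list \<Rightarrow> instr \<Rightarrow> real" where
  "instr_value m (Load r) = r"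
| "instr_value m (Add i j) = m ! i + m ! j"
| "instr_value m (Sub i j) = m ! i - m ! j"
| "instr_value m (Mul i j) = m ! i * m ! j"

fun operands :: "instr \<Rightarrow> nat set" where
  "operands (Load r) = {}"
| "operands (Add i j) = {i, j}"
| "operands (Sub i j) = {i, j}"
| "operands (Mul i j) = {i, j}"

definition run :: "instr list \<Rightarrow> real list \<Rightarrow> real list" where
  "run p m = fold (\<lambda>I m. m @ [instr_value m I]) p m"

definition program_wf :: "nat \<Rightarrow> instr list \<Rightarrow> bool" where
  "program_wf n p \<longleftrightarrow> (\<forall>t<length p. operands (p ! t) \<subseteq> {..<n + t})"

text \<open>\<open>outs\<close> lists the memory addresses of the output entries, row by row.\<close>

definition computable_in_time :: "nat \<Rightarrow> nat \<Rightarrow> (real mat \<Rightarrow> real mat) \<Rightarrow> nat \<Rightarrow> bool" where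
  "computable_in_time N d f t \<longleftrightarrow> (\<exists>p outs.
     length p \<le> t \<and> program_wf (N * d) p \<and> set outs \<subseteq> {..<N * d + length p} \<and>
     (\<forall>u\<in>carrier_mat N d.
        map (\<lambda>i. run p (concat (mat_to_list u)) ! i) outs = concat (mat_to_list (f u))))"


section \<open>Multi-query associative recall\<close>

definition embedding :: "nat set \<Rightarrow> nat \<Rightarrow> (nat \<Rightarrow> real vec) \<Rightarrow> bool" where
  "embedding C d emb \<longleftrightarrow> inj_on emb C \<and>
     (\<forall>x\<in>C. emb x \<in> carrier_vec d \<and> (\<forall>l<d. emb x $ l \<in> {0, 1}))"

definition embed_tokens :: "nat \<Rightarrow> nat \<Rightarrow> (nat \<Rightarrow> real vec) \<Rightarrow> (nat \<Rightarrow> nat) \<Rightarrow> real mat" where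
  "embed_tokens N d emb x = mat N d (\<lambda>(i, l). emb (x i) $ l)"

text \<open>\<open>V\<close> is the set of embedded tokens. If several earlier positions \<open>j\<close> match the query,
  the successor of any one of them is accepted. If none matches, the output row must not be an
  embedded token, so that the output also answers whether a match exists.\<close>

definition solves_mqar :: "real vec set \<Rightarrow> real mat \<Rightarrow> real mat \<Rightarrow> bool" where
  "solves_mqar V u out \<longleftrightarrow> (\<forall>i. 1 \<le> i \<and> i < dim_row u \<longrightarrow>
     (if \<exists>j<i. row u i = row u j
      then \<exists>j<i. row u i = row u j \<and> row out i = row u (j + 1)
      else row out i \<notin> V))"


section \<open>Poly-logarithmic factors\<close>

text \<open>The summand 1 keeps the factor bounded away from 0 for small arguments.\<close>

definition polylog :: "real \<Rightarrow> nat \<Rightarrow> real \<Rightarrow> real" where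
  "polylog A a s = A * (1 + log 2 s) ^ a"

end

theory Submission
  imports Defs
begin

text \<open>A sorting network is run on records (token, position, next token), compared
  lexicographically by token and then position. Afterwards the latest earlier occurrence of the token
  of a record, if there is one, sits in the preceding row, so one comparison with that row yields the
  answer, and a second sort by position moves the answers back. The output row of a query without a
  match is constantly 2, which is not an embedded token.

  The network is Pratt's variant of Shellsort with the increments \<open>2 ^ p * 3 ^ q\<close>. On a sequence that
  is \<open>2 h\<close>- and \<open>3 h\<close>-ordered, one parallel pass \<open>y i = max (x (i - h)) (min (x i) (x (i + h)))\<close>
  exchanges disjoint pairs and makes the sequence \<open>h\<close>-ordered; being monotone in \<open>x\<close>, it preserves
  \<open>k\<close>-orderedness for all \<open>k\<close>. There are only \<open>O(log\<^sup>2 N)\<close> passes. Moving rows is a convolution with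
  a monomial, and every mixing of columns that is needed exchanges columns whose numbers differ in one
  bit, which is a single butterfly factor.\<close>

section \<open>Pratt's sorting network\<close>

text \<open>The filters may not depend on the input, so the rows to be compared must be fixed in
  advance; hence a sorting network. All pairs of a Pratt pass have the same distance
  \<open>h\<close>, so one circular shift in each direction serves every row, and \<open>N\<close>
  need not be a power of 2. A layer can only multiply two affine expressions, so decisions become
  polynomials: two rows are compared by combining signs along a tree of logarithmic depth, and a
  swap is the addition of a masked difference. The position belongs to the key in order to separate
  equal tokens; distinct positions also let the second sort undo the first. The final exponent 5
  collects two logarithms from the number of passes, one from the layers per pass, one from the
  number of columns (linear in \<open>d + log N\<close>) and one from the number of butterfly
  factors counted as parameters.\<close>

definition shell_pass :: "int \<Rightarrow> (int \<Rightarrow> int) \<Rightarrow> int \<Rightarrow> int" where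
  "shell_pass h v i = max (v (i - h)) (min (v i) (v (i + h)))"

lemma shell_pass_preserves:
  assumes "\<forall>i. v i \<le> v (i + k)"
  shows "shell_pass h v i \<le> shell_pass h v (i + k)"
proof -
  have "v (i - h) \<le> v (i + k - h)" "v i \<le> v (i + k)" "v (i + h) \<le> v (i + k + h)"
    using assms spec[OF assms, of "i - h"] spec[OF assms, of "i + h"] by (auto simp: algebra_simps)
  then show ?thesis
    unfolding shell_pass_def by (intro max.mono min.mono)
qed

text \<open>By the orders for \<open>2 * h\<close> and \<open>3 * h\<close>,
  \<open>v (i - h)\<close> is below both arguments of the minimum formed at \<open>i + h\<close>;
  the minimum formed at \<open>i\<close> is below \<open>v i\<close>, which is the other argument of
  the maximum at \<open>i + h\<close>.\<close>

lemma shell_pass_sorts: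
  assumes "\<forall>i. v i \<le> v (i + 2 * h)" and "\<forall>i. v i \<le> v (i + 3 * h)"
  shows "shell_pass h v i \<le> shell_pass h v (i + h)"
proof -
  have "v (i - h) \<le> v (i + h)" "v (i - h) \<le> v (i + h + h)"
    using spec[OF assms(1), of "i - h"] spec[OF assms(2), of "i - h"] by (auto simp: algebra_simps)
  then show ?thesis
    unfolding shell_pass_def by auto
qed

text \<open>This gives the source index: the sequence after a pass is
  \<open>v \<circ> exchange n h v\<close>. Strict comparisons leave equal values in place.\<close>

definition exchange :: "nat \<Rightarrow> nat \<Rightarrow> (nat \<Rightarrow> nat) \<Rightarrow> nat \<Rightarrow> nat" where
  "exchange n h v i = (if i + h < n \<and> v (i + h) < v i then i + h
     else if h \<le> i \<and> v i < v (i - h) then i - h else i)"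

text \<open>Outside of \<open>{..<n}\<close> a sequence is continued by a lower and an upper bound of its values,
  so that a pass needs no case distinction at the boundary.\<close>

definition extend :: "nat \<Rightarrow> int \<Rightarrow> (nat \<Rightarrow> nat) \<Rightarrow> int \<Rightarrow> int" where
  "extend n b v i = (if i < 0 then - 1 else if i < int n then int (v (nat i)) else b)"

definition h_ordered :: "nat \<Rightarrow> (nat \<Rightarrow> nat) \<Rightarrow> nat \<Rightarrow> bool" where
  "h_ordered n v h \<longleftrightarrow> (\<forall>i. i + h < n \<longrightarrow> v i \<le> v (i + h))"

lemma h_ordered_extend:
  assumes "\<forall>i<n. int (v i) < b" and "0 \<le> b"
  shows "h_ordered n v h \<longleftrightarrow> (\<forall>i. extend n b v i \<le> extend n b v (i + int h))"
proof
  assume *: "h_ordered n v h"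
  show "\<forall>i. extend n b v i \<le> extend n b v (i + int h)"
  proof
    fix i :: int
    show "extend n b v i \<le> extend n b v (i + int h)"
    proof (cases "0 \<le> i \<and> i + int h < int n")
      case True
      then have "v (nat i) \<le> v (nat i + h)" using * by (auto simp: h_ordered_def)
      with True show ?thesis by (auto simp: extend_def nat_add_distrib)
    next
      case False
      then show ?thesis using assms by (auto simp: extend_def less_imp_le)
    qed
  qed
next
  assume *: "\<forall>i. extend n b v i \<le> extend n b v (i + int h)"
  show "h_ordered n v h"
    unfolding h_ordered_def
  proof (intro allI impI)
    fix i assume "i + h < n"
    then show "v i \<le> v (i + h)"
      using spec[OF *, of "int i"] by (auto simp: extend_def nat_add_distrib)
  qed
qed

lemma exchange_eq_shell_pass:
  assumes "0 < h" and "h_ordered n v (2 * h)" and "\<forall>i<n. int (v i) < b" and "0 \<le> b"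
  shows "extend n b (v \<circ> exchange n h v) i = shell_pass (int h) (extend n b v) i"
proof -
  consider "i < 0" | "int n \<le> i" | k where "i = int k" "k < n"
    by (metis not_le zero_le_imp_eq_int of_nat_less_iff)
  then show ?thesis
  proof cases
    case 1
    then show ?thesis using assms by (auto simp: shell_pass_def extend_def)
  next
    case 2
    then show ?thesis using assms(3,4) by (auto simp: shell_pass_def extend_def less_imp_le)
  next
    case 3
    \<comment> \<open>If \<open>k\<close> and \<open>k + h\<close> are inverted, the minimum is
      \<open>v (k + h)\<close>; the \<open>2 * h\<close>-order puts \<open>v (k - h)\<close> below
      it, so the outer maximum changes nothing.\<close>
    have o: "v (k - h) \<le> v (k + h)" if "h \<le> k" "k + h < n"
      using assms(2) that unfolding h_ordered_def by (auto dest!: spec[of _ "k - h"] simp: add.commute)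
    have lo: "extend n b v (i - int h) = (if h \<le> k then int (v (k - h)) else - 1)"
      using 3 by (auto simp: extend_def nat_diff_distrib)
    have hi: "extend n b v (i + int h) = (if k + h < n then int (v (k + h)) else b)"
      using 3 by (auto simp: extend_def nat_add_distrib)
    have mid: "extend n b w i = int (w k)" for w
      using 3 by (auto simp: extend_def)
    show ?thesis
      unfolding shell_pass_def lo hi mid using o 3 assms(3)
      by (auto simp: exchange_def not_less min_def max_def split: if_splits)
  qed
qed

text \<open>The \<open>2 * h\<close>-order forbids two consecutive inversions along a chain of step
  \<open>h\<close>. So no index belongs to two inverted pairs, and the exchange is its own
  inverse.\<close>

lemma exchange_bij:
  assumes "h_ordered n v (2 * h)"
  shows "bij_betw (exchange n h v) {..<n} {..<n}"
proof (rule bij_betw_byWitness[where f' = "exchange n h v"])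
  show "exchange n h v ` {..<n} \<subseteq> {..<n}" by (auto simp: exchange_def)
  then show "exchange n h v ` {..<n} \<subseteq> {..<n}" .
  have "exchange n h v (exchange n h v i) = i" if "i < n" for i
  proof -
    have o: "v j \<le> v (j + h + h)" if "j + h + h < n" for j
      using assms that by (auto simp: h_ordered_def mult_2 add.assoc)
    consider "i + h < n" "v (i + h) < v i" | "\<not> (i + h < n \<and> v (i + h) < v i)" "h \<le> i" "v i < v (i - h)"
      | "exchange n h v i = i" unfolding exchange_def by argo
    then show ?thesis
    proof cases
      case 1
      then show ?thesis using o[of i] by (auto simp: exchange_def)
    next
      case 2
      then show ?thesis using that by (auto simp: exchange_def)
    qed auto
  qed
  then show "\<forall>i\<in>{..<n}. exchange n h v (exchange n h v i) = i" by auto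
  then show "\<forall>i\<in>{..<n}. exchange n h v (exchange n h v i) = i" .
qed

lemma exchange_h_ordered:
  assumes "0 < h" and "h_ordered n v (2 * h)" and "h_ordered n v (3 * h)"
  shows "h_ordered n (v \<circ> exchange n h v) h"
    and "h_ordered n v k \<Longrightarrow> h_ordered n (v \<circ> exchange n h v) k"
proof -
  define b where "b = int (\<Sum>i<n. v i) + 1"
  have "v i \<le> (\<Sum>i<n. v i)" if "i < n" for i
    using that by (intro member_le_sum) auto
  then have b: "\<forall>i<n. int (v i) < b" "0 \<le> b" by (auto simp: b_def zless_add1_eq order_le_less sum_nonneg simp flip: of_nat_sum)
  have ran: "exchange n h v i < n" if "i < n" for i using that by (auto simp: exchange_def)
  have b': "\<forall>i<n. int ((v \<circ> exchange n h v) i) < b" using b ran by auto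
  note E = h_ordered_extend[OF b] h_ordered_extend[OF b' b(2)]
  have eq: "extend n b (v \<circ> exchange n h v) = shell_pass (int h) (extend n b v)"
    using exchange_eq_shell_pass[OF assms(1,2) b] by blast
  show "h_ordered n (v \<circ> exchange n h v) h"
    using assms(2,3) shell_pass_sorts[of "extend n b v" "int h"] unfolding E eq by simp
  show "h_ordered n (v \<circ> exchange n h v) k" if "h_ordered n v k"
    using that shell_pass_preserves[of "extend n b v" "int k"] unfolding E eq by simp
qed

lemma h_ordered_ge: "n \<le> h \<Longrightarrow> h_ordered n v h"
  by (simp add: h_ordered_def)

text \<open>The increments \<open>2 ^ p * 3 ^ q\<close> of Pratt, arranged so that \<open>2 h\<close> and \<open>3 h\<close> precede \<open>h\<close>.\<close>

definition pratt :: "nat \<Rightarrow> nat list" where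
  "pratt m = concat (map (\<lambda>q. map (\<lambda>p. 2 ^ p * 3 ^ q) (rev [0..<m])) (rev [0..<m]))"

lemma length_pratt: "length (pratt m) = m * m"
  by (simp add: pratt_def length_concat comp_def sum_list_triv)

lemma pratt_pos: "h \<in> set (pratt m) \<Longrightarrow> 0 < h"
  by (auto simp: pratt_def)

lemma h_ordered_1:
  assumes "h_ordered n v 1" and "i \<le> j" and "j < n"
  shows "v i \<le> v j"
  using assms(2,3)
proof (induction j rule: dec_induct)
  case base
  then show ?case by simp
next
  case (step m)
  then have "v i \<le> v m" by simp
  also have "v m \<le> v (Suc m)" using assms(1) step by (auto simp: h_ordered_def)
  finally show ?case .
qed

text \<open>For \<open>h \<ge> n\<close> there is no pair to compare, and skipping such increments
  keeps the cyclic shifts shorter than the cycle.\<close>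

definition shell_step :: "nat \<Rightarrow> nat \<Rightarrow> (nat \<Rightarrow> nat) \<Rightarrow> nat \<Rightarrow> nat" where
  "shell_step n h v = (if h < n then v \<circ> exchange n h v else v)"

lemma shell_step_ordered:
  assumes "0 < h" and "h_ordered n v (2 * h)" and "h_ordered n v (3 * h)"
  shows "h_ordered n (shell_step n h v) h"
    and "h_ordered n v k \<Longrightarrow> h_ordered n (shell_step n h v) k"
  using exchange_h_ordered[OF assms] h_ordered_ge[of n h v] by (auto simp: shell_step_def)

text \<open>An abstract invariant \<open>R\<close> is carried along so that the same induction serves every
  implementation of the passes.\<close>

lemma pratt_induct:
  fixes R :: "'s \<Rightarrow> (nat \<Rightarrow> nat) \<Rightarrow> bool"
  assumes R0: "R s v" and n: "n \<le> 2 ^ m"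
    and step: "\<And>h s v. \<lbrakk>h \<in> set (pratt m); R s v; h_ordered n v (2 * h)\<rbrakk> \<Longrightarrow> R (f h s) (shell_step n h v)"
  shows "\<exists>v'. R (fold f (pratt m) s) v' \<and> h_ordered n v' 1"
proof -
  \<comment> \<open>Increments with exponent \<open>m\<close> in either base are at least
    \<open>n\<close>, so their orders hold vacuously and start both downward inductions.\<close>
  have n3: "n \<le> 3 ^ m" using n power_mono[of 2 "3::nat" m] by linarith
  \<comment> \<open>This treats the block of one fixed \<open>q\<close>. The last conjunct, that all
    orders survive, carries the results of earlier blocks forward.\<close>
  have inner: "\<exists>v'. R (fold f (map (\<lambda>p. 2 ^ p * 3 ^ q) (rev [0..<m'])) s) v' \<and>
      (\<forall>p<m'. h_ordered n v' (2 ^ p * 3 ^ q)) \<and> (\<forall>k. h_ordered n v k \<longrightarrow> h_ordered n v' k)"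
    if "R s v" "m' \<le> m" "q < m" "h_ordered n v (2 ^ m' * 3 ^ q)"
      "\<forall>p<m. h_ordered n v (2 ^ p * 3 ^ Suc q)" for s v q m'
    using that
  proof (induction m' arbitrary: s v)
    case 0
    then show ?case by auto
  next
    case (Suc m')
    let ?h = "2 ^ m' * 3 ^ q :: nat"
    have mem: "?h \<in> set (pratt m)" using Suc.prems by (force simp: pratt_def)
    have two: "h_ordered n v (2 * ?h)" using Suc.prems by (simp add: mult.assoc)
    have "3 * ?h = 2 ^ m' * 3 ^ Suc q" by simp
    then have three: "h_ordered n v (3 * ?h)" using Suc.prems by (metis Suc_le_eq)
    note o = shell_step_ordered[OF pratt_pos[OF mem] two three]
    have "\<exists>v'. R (fold f (map (\<lambda>p. 2 ^ p * 3 ^ q) (rev [0..<m'])) (f ?h s)) v' \<and>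
      (\<forall>p<m'. h_ordered n v' (2 ^ p * 3 ^ q)) \<and>
      (\<forall>k. h_ordered n (shell_step n ?h v) k \<longrightarrow> h_ordered n v' k)"
      by (rule Suc.IH) (use step[OF mem Suc.prems(1) two] o Suc.prems in auto)
    then show ?case using o by (auto simp: less_Suc_eq)
  qed
  have "\<exists>v'. R (fold f (concat (map (\<lambda>q. map (\<lambda>p. 2 ^ p * 3 ^ q) (rev [0..<m])) (rev [0..<m']))) s) v' \<and>
      (\<forall>p<m. \<forall>q<m'. h_ordered n v' (2 ^ p * 3 ^ q)) \<and> (\<forall>k. h_ordered n v k \<longrightarrow> h_ordered n v' k)"
    if "R s v" "m' \<le> m" "\<forall>p<m. h_ordered n v (2 ^ p * 3 ^ m')" for s v m'
    using that
  proof (induction m' arbitrary: s v)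
    case 0
    then show ?case by auto
  next
    case (Suc q)
    have "n \<le> 2 ^ m * 3 ^ q" by (rule le_trans[OF n]) simp
    then have "h_ordered n v (2 ^ m * 3 ^ q)" by (rule h_ordered_ge)
    then obtain v1 where v1: "R (fold f (map (\<lambda>p. 2 ^ p * 3 ^ q) (rev [0..<m])) s) v1"
      "\<forall>p<m. h_ordered n v1 (2 ^ p * 3 ^ q)" "\<forall>k. h_ordered n v k \<longrightarrow> h_ordered n v1 k"
      using inner[of s v m q] Suc.prems by auto
    obtain v' where "R (fold f (concat (map (\<lambda>q. map (\<lambda>p. 2 ^ p * 3 ^ q) (rev [0..<m])) (rev [0..<q])))
        (fold f (map (\<lambda>p. 2 ^ p * 3 ^ q) (rev [0..<m])) s)) v'"
      "\<forall>p<m. \<forall>q'<q. h_ordered n v' (2 ^ p * 3 ^ q')" "\<forall>k. h_ordered n v1 k \<longrightarrow> h_ordered n v' k"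
      using Suc.IH[OF v1(1)] Suc.prems v1 by auto
    then show ?case using v1 by (auto simp: less_Suc_eq)
  qed
  note outer = this
  have "h_ordered n v (2 ^ p * 3 ^ m)" for p
    by (intro h_ordered_ge le_trans[OF n3]) simp
  then have "\<exists>v'. R (fold f (pratt m) s) v' \<and> (\<forall>p<m. \<forall>q<m. h_ordered n v' (2 ^ p * 3 ^ q))"
    using outer[OF R0, of m] unfolding pratt_def by blast
  then obtain v' where v': "R (fold f (pratt m) s) v'" "\<forall>p<m. \<forall>q<m. h_ordered n v' (2 ^ p * 3 ^ q)" by blast
  have "h_ordered n v' 1"
  proof (cases "m = 0")
    case True
    then show ?thesis using n by (auto intro!: h_ordered_ge)
  next
    case False
    then show ?thesis using v'(2)[rule_format, of 0 0] by simp
  qed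
  with v' show ?thesis by blast
qed

section \<open>Column exchanges as Kaleidoscope matrices\<close>

text \<open>Bitwise exclusive or of \<open>c\<close> with \<open>2 ^ s\<close>.\<close>

definition flip :: "nat \<Rightarrow> nat \<Rightarrow> nat" where
  "flip s c = (if even (c div 2 ^ s) then c + 2 ^ s else c - 2 ^ s)"

lemma flip_block:
  assumes "i < 2 ^ Suc s"
  shows "flip s (q * 2 ^ Suc s + i) = q * 2 ^ Suc s + (if i < 2 ^ s then i + 2 ^ s else i - 2 ^ s)"
proof -
  have "(q * 2 ^ Suc s + i) div 2 ^ s = (i + (2 * q) * 2 ^ s) div 2 ^ s"
    by (simp add: algebra_simps)
  also have "\<dots> = 2 * q + i div 2 ^ s"
    by (subst div_mult_self1) auto
  finally have *: "(q * 2 ^ Suc s + i) div 2 ^ s = 2 * q + i div 2 ^ s" .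
  show ?thesis
  proof (cases "i < 2 ^ s")
    case True
    then show ?thesis using * by (simp add: flip_def)
  next
    case False
    have "i div 2 ^ s = 1"
      by (rule div_nat_eqI) (use False assms in auto)
    then show ?thesis using * False by (simp add: flip_def)
  qed
qed

text \<open>A column number splits into a high part (register or field) and an offset
  \<open>l\<close>; a bit above the offset moves only the high part. It is used at both
  granularities.\<close>

lemma flip_add:
  assumes "l < 2 ^ k"
  shows "flip (k + j) (r * 2 ^ k + l) = flip j r * 2 ^ k + l"
proof -
  have "(r * 2 ^ k + l) div 2 ^ (k + j) = r div 2 ^ j"
    using assms by (simp add: power_add div_mult2_eq)
  moreover have "2 ^ j \<le> r" if "odd (r div 2 ^ j)"
    using that by (metis div_less even_zero not_le)
  ultimately show ?thesis
    by (auto simp: flip_def power_add algebra_simps diff_mult_distrib)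
qed

lemma flip_lower:
  assumes "l < 2 ^ k" and "s < k"
  shows "flip s (r * 2 ^ k + l) = r * 2 ^ k + flip s l" and "flip s l < 2 ^ k"
proof -
  obtain j where k: "k = Suc s + j"
    using assms(2) less_imp_Suc_add by auto
  define q i where "q = l div 2 ^ Suc s" and "i = l mod 2 ^ Suc s"
  have l: "l = q * 2 ^ Suc s + i" and i: "i < 2 ^ Suc s"
    by (auto simp only: q_def i_def div_mult_mod_eq intro!: mod_less_divisor zero_less_power)
  have q: "q < 2 ^ j"
    using assms(1) unfolding q_def k by (intro less_mult_imp_div_less) (simp add: power_add algebra_simps)
  have eq: "r * 2 ^ k + l = (r * 2 ^ j + q) * 2 ^ Suc s + i"
    unfolding k by (subst l) (simp add: power_add algebra_simps)
  show "flip s (r * 2 ^ k + l) = r * 2 ^ k + flip s l"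
    unfolding eq flip_block[OF i] unfolding l flip_block[OF i]
    by (simp add: k power_add algebra_simps)
  have "flip s l < (q + 1) * 2 ^ Suc s"
    unfolding l flip_block[OF i] using i by auto
  also have "\<dots> \<le> 2 ^ j * 2 ^ Suc s"
    by (rule mult_le_mono1) (use q in simp)
  finally show "flip s l < 2 ^ k" by (simp add: k power_add mult.commute)
qed

lemma flip_Suc_0 [simp]: "flip (Suc 0) 0 = 2" "flip (Suc 0) 1 = 3" "flip (Suc 0) (Suc 0) = 3"
    "flip (Suc 0) 2 = 0" "flip (Suc 0) 3 = 1"
  and flip_0 [simp]: "flip 0 0 = 1" "flip 0 1 = 0" "flip 0 (Suc 0) = 0" "flip 0 2 = 3" "flip 0 3 = 2"
  by (simp_all add: flip_def)

text \<open>Weights multiply from the right, so the coefficients are indexed by the target column: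
  column \<open>j\<close> of the product is \<open>a j\<close> times column \<open>j\<close> plus
  \<open>b j\<close> times column \<open>flip s j\<close>.\<close>

definition flip_mat :: "nat \<Rightarrow> nat \<Rightarrow> (nat \<Rightarrow> real) \<Rightarrow> (nat \<Rightarrow> real) \<Rightarrow> real mat" where
  "flip_mat n s a b = mat n n (\<lambda>(i, j). (if i = j then a j else 0) + (if i = flip s j then b j else 0))"

lemma diag_block_mat_uniform:
  assumes "\<forall>F\<in>set Fs. F \<in> carrier_mat k k" and "0 < k"
  shows "diag_block_mat Fs = mat (length Fs * k) (length Fs * k)
    (\<lambda>(i, j). if i div k = j div k then (Fs ! (i div k)) $$ (i mod k, j mod k) else 0)"
  using assms
proof (induction Fs)
  case Nil
  then show ?case by auto
next
  case (Cons F Fs)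
  have IH: "diag_block_mat Fs = mat (length Fs * k) (length Fs * k)
    (\<lambda>(i, j). if i div k = j div k then (Fs ! (i div k)) $$ (i mod k, j mod k) else 0)"
    using Cons by auto
  have F: "dim_row F = k" "dim_col F = k" using Cons.prems by auto
  have d: "i div k = Suc ((i - k) div k)" "i mod k = (i - k) mod k" if "\<not> i < k" for i
    using that \<open>0 < k\<close> by (simp_all add: le_div_geq le_mod_geq)
  show ?case
    by (rule eq_matI) (auto simp: IH F four_block_mat_def Let_def d)
qed

text \<open>Within a block of size \<open>2 ^ Suc s\<close>, flipping bit \<open>s\<close> swaps the
  two halves, so \<open>a\<close> fills the diagonal quadrants and \<open>b\<close> the other two.
  Coefficients are read at the column, hence the offset \<open>h\<close> in both right
  quadrants.\<close>

lemma flip_mat_block: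
  fixes a b :: "nat \<Rightarrow> real" and q s :: nat
  defines "k \<equiv> 2 ^ Suc s" and "h \<equiv> 2 ^ s"
  defines "F \<equiv> four_block_mat
      (mat h h (\<lambda>(i, j). if i = j then a (q * k + j) else 0))
      (mat h h (\<lambda>(i, j). if i = j then b (q * k + h + j) else 0))
      (mat h h (\<lambda>(i, j). if i = j then b (q * k + j) else 0))
      (mat h h (\<lambda>(i, j). if i = j then a (q * k + h + j) else 0))"
  shows "F \<in> butterfly_factors k" and "F \<in> carrier_mat k k"
    and "\<lbrakk>i < k; j < k\<rbrakk> \<Longrightarrow> F $$ (i, j) =
      (if i = j then a (q * k + j) else 0) + (if q * k + i = flip s (q * k + j) then b (q * k + j) else 0)"
proof -
  have [simp]: "k div 2 = h" by (simp add: k_def h_def)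
  have k: "k = h + h" by (simp add: k_def h_def)
  show "F \<in> butterfly_factors k"
    unfolding butterfly_factors_def F_def by (auto simp: diagonal_mat_def intro!: exI)
  show "F \<in> carrier_mat k k"
    by (auto simp: F_def k)
  show "F $$ (i, j) = (if i = j then a (q * k + j) else 0)
      + (if q * k + i = flip s (q * k + j) then b (q * k + j) else 0)" if "i < k" "j < k"
    using that flip_block[of j s q, folded k_def h_def]
    by (auto simp: F_def k four_block_mat_def Let_def)
qed

lemma flip_mat_butterfly_factor:
  assumes "s < m"
  shows "flip_mat (2 ^ m) s a b \<in> butterfly_factor_matrices (2 ^ m) (2 ^ Suc s)"
proof -
  define k h :: nat where "k = 2 ^ Suc s" and "h = 2 ^ s"
  define F where "F q = four_block_mat
      (mat h h (\<lambda>(i, j). if i = j then a (q * k + j) else 0))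
      (mat h h (\<lambda>(i, j). if i = j then b (q * k + h + j) else 0))
      (mat h h (\<lambda>(i, j). if i = j then b (q * k + j) else 0))
      (mat h h (\<lambda>(i, j). if i = j then a (q * k + h + j) else 0))" for q
  note F = flip_mat_block[where s = s and a = a and b = b, folded k_def h_def, folded F_def]
  have kpos: "0 < k" by (simp add: k_def)
  obtain j where m: "m = Suc s + j"
    using assms less_imp_Suc_add by auto
  define n :: nat where "n = 2 ^ j"
  have n: "2 ^ m = n * k"
    by (simp add: n_def m k_def power_add algebra_simps)
  \<comment> \<open>Flipping stays within a block, so entries outside the diagonal blocks
    vanish.\<close>
  have fl: "flip s j div k = j div k" for j
  proof -
    have "flip s j = (j div k) * k + (if j mod k < 2 ^ s then j mod k + 2 ^ s else j mod k - 2 ^ s)"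
      using flip_block[of "j mod k" s "j div k", folded k_def] kpos by simp
    moreover have "(if j mod k < 2 ^ s then j mod k + 2 ^ s else j mod k - 2 ^ s) < k"
      using mod_less_divisor[OF kpos, of j] unfolding k_def by (auto simp del: mod_less_divisor)
    ultimately show ?thesis by (metis div_mult_self3 div_less add.right_neutral less_not_refl2 kpos)
  qed
  have "flip_mat (2 ^ m) s a b = diag_block_mat (map F [0..<n])"
  proof (subst diag_block_mat_uniform[of _ k])
    show "flip_mat (2 ^ m) s a b = mat (length (map F [0..<n]) * k) (length (map F [0..<n]) * k)
       (\<lambda>(i, j). if i div k = j div k then map F [0..<n] ! (i div k) $$ (i mod k, j mod k) else 0)"
    proof (rule eq_matI, goal_cases)
      case (1 i j)
      then have ij: "i < n * k" "j < n * k" by auto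
      then have lt: "i div k < n" "j div k < n" by (auto simp: less_mult_imp_div_less)
      show ?case
      proof (cases "i div k = j div k")
        case True
        have i: "i = j div k * k + i mod k" using True by (metis div_mult_mod_eq)
        have j: "j = j div k * k + j mod k" by simp
        have "i mod k = j mod k \<longleftrightarrow> i = j" using True by (metis div_mult_mod_eq)
        then show ?thesis using ij lt True F(3)[of "i mod k" "j mod k" "j div k"] kpos i j
          by (simp add: flip_mat_def n)
      next
        case False
        then have "i \<noteq> j" "i \<noteq> flip s j" using fl by auto
        with False show ?thesis using ij by (simp add: flip_mat_def n)
      qed
    qed (auto simp: flip_mat_def n)
  qed (use F(2) kpos in auto)
  then show ?thesis
    using F(1) kpos unfolding butterfly_factor_matrices_def k_def[symmetric] n
    by (auto intro!: exI[of _ "map F [0..<n]"])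
qed

lemma one_mat_flip_mat: "1\<^sub>m n = flip_mat n s (\<lambda>_. 1) (\<lambda>_. 0)"
  by (auto simp: flip_mat_def)

lemma mat_prod_single:
  assumes "distinct xs" and "W \<in> carrier_mat n n"
  shows "mat_prod n (map (\<lambda>i. if i = x then W else 1\<^sub>m n) xs) = (if x \<in> set xs then W else 1\<^sub>m n)"
  using assms by (induction xs) (auto simp: mat_prod_def)

lemma flip_mat_carrier [simp]: "flip_mat n s a b \<in> carrier_mat n n"
  by (simp add: flip_mat_def)

text \<open>The matrix takes the place of the factor \<open>B (Suc s)\<close>; every other factor is
  the identity, itself a \<open>flip_mat\<close> at any level.\<close>

lemma flip_mat_butterfly:
  assumes "s < m"
  shows "flip_mat (2 ^ m) s a b \<in> butterfly_matrices (2 ^ m)"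
proof -
  let ?W = "flip_mat (2 ^ m) s a b"
  let ?B = "\<lambda>i. if i = Suc s then ?W else 1\<^sub>m (2 ^ m)"
  have "?W = mat_prod (2 ^ m) (map ?B (rev [1..<Suc m]))"
    using assms by (subst mat_prod_single) auto
  moreover have "?B i \<in> butterfly_factor_matrices (2 ^ m) (2 ^ i)" if "i \<in> {1..m}" for i
  proof (cases "i = Suc s")
    case True
    then show ?thesis using flip_mat_butterfly_factor[OF assms] by simp
  next
    case False
    obtain j where "i = Suc j" using \<open>i \<in> {1..m}\<close> by (cases i) auto
    then show ?thesis
      using flip_mat_butterfly_factor[of j m] False \<open>i \<in> {1..m}\<close> one_mat_flip_mat[of "2 ^ m" j] by auto
  qed
  ultimately show ?thesis unfolding butterfly_matrices_def by blast
qed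

text \<open>The transposed butterfly matrix is chosen as the identity, and with expansion 1 the
  selection matrix is the identity too, so the smallest width and expansion suffice.\<close>

lemma flip_mat_kaleidoscope:
  assumes "s < m"
  shows "flip_mat (2 ^ m) s a b \<in> kaleidoscope 1 1 (2 ^ m)"
proof -
  let ?W = "flip_mat (2 ^ m) s a b"
  have sel: "selection_mat (2 ^ m) (1 * 2 ^ m) = 1\<^sub>m (2 ^ m)"
    by (auto simp: selection_mat_def)
  have "?W = ?W * transpose_mat (1\<^sub>m (2 ^ m))"
    by (simp add: right_mult_one_mat[OF flip_mat_carrier])
  moreover have "1\<^sub>m (2 ^ m) \<in> butterfly_matrices (2 ^ m)"
    using flip_mat_butterfly[OF assms, of "\<lambda>_. 1" "\<lambda>_. 0"] one_mat_flip_mat[of "2 ^ m" s] by simp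
  ultimately have "?W \<in> BBstar (2 ^ m)"
    unfolding BBstar_def using flip_mat_butterfly[OF assms] by blast
  moreover have "?W = mat_prod (2 ^ m) [?W]"
    by (simp add: mat_prod_def right_mult_one_mat[OF flip_mat_carrier])
  ultimately have "?W \<in> BBstar_power 1 (1 * 2 ^ m)"
    unfolding BBstar_power_def by (auto intro!: exI[of _ "[?W]"])
  moreover have "?W = 1\<^sub>m (2 ^ m) * ?W * transpose_mat (1\<^sub>m (2 ^ m))"
    by (simp add: left_mult_one_mat[OF flip_mat_carrier] right_mult_one_mat[OF flip_mat_carrier])
  ultimately show ?thesis unfolding kaleidoscope_def sel by blast
qed

section \<open>Layers with monomial filters and their cost\<close>

lemma monom_mod_cyclic:
  fixes g :: "'a::field"
  assumes "0 < n" and "i < 2 * n"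
  shows "monom g i mod (monom 1 n - 1) = monom g (i mod n)"
proof -
  have deg: "degree (monom 1 n - 1 :: 'a poly) = n"
    using assms(1) by (subst diff_conv_add_uminus, subst degree_add_eq_left) (auto simp: degree_monom_eq)
  have lt: "monom g j mod (monom 1 n - 1) = monom g j" if "j < n" for j
    by (rule mod_poly_less) (use that deg degree_monom_le[of g j] in auto)
  show ?thesis
  proof (cases "i < n")
    case True
    then show ?thesis using lt by simp
  next
    case False
    have "monom g i = monom g (i - n) + monom g (i - n) * (monom 1 n - 1)"
      using False by (simp add: algebra_simps mult_monom)
    then have "monom g i mod (monom 1 n - 1) = monom g (i - n) mod (monom 1 n - 1)"
      by (metis mod_mult_self1)
    then show ?thesis using False assms lt[of "i - n"] by (simp add: le_mod_geq)
  qed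
qed

lemma poly_mod_sum:
  fixes q :: "'a::field poly"
  shows "(\<Sum>i\<in>I. f i) mod q = (\<Sum>i\<in>I. f i mod q)"
  by (induction I rule: infinite_finite_induct) (auto simp: poly_mod_add_left)

text \<open>Since \<open>X ^ n\<close> is 1 in the quotient, multiplication by \<open>X ^ p\<close>
  rotates the coefficients. The summand \<open>n\<close> in the index avoids truncated
  subtraction.\<close>

lemma coeff_monom_mult_mod_cyclic:
  fixes q :: "'a::field poly"
  assumes "p < n" and "\<And>i. n \<le> i \<Longrightarrow> coeff q i = 0" and "j < n"
  shows "coeff ((monom g p * q) mod (monom 1 n - 1)) j = g * coeff q ((j + n - p) mod n)"
proof -
  have "degree q \<le> n - 1"
    using assms(1,2) by (intro degree_le) auto
  then have "{..degree q} \<subseteq> {..<n}" using assms(1) by auto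
  then have "(\<Sum>i\<le>degree q. monom (coeff q i) i) = (\<Sum>i<n. monom (coeff q i) i)"
    by (intro sum.mono_neutral_left) (auto simp: coeff_eq_0)
  then have "q = (\<Sum>i<n. monom (coeff q i) i)"
    by (simp add: poly_as_sum_of_monoms)
  then have "monom g p * q = (\<Sum>i<n. monom (g * coeff q i) (p + i))"
    by (metis (no_types, lifting) sum_distrib_left mult_monom sum.cong)
  then have "(monom g p * q) mod (monom 1 n - 1)
      = (\<Sum>i<n. monom (g * coeff q i) (p + i) mod (monom 1 n - 1))"
    by (simp add: poly_mod_sum)
  also have "\<dots> = (\<Sum>i<n. monom (g * coeff q i) ((p + i) mod n))"
    by (intro sum.cong refl monom_mod_cyclic) (use assms(1) in auto)
  finally have "coeff ((monom g p * q) mod (monom 1 n - 1)) j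
      = (\<Sum>i<n. if (p + i) mod n = j then g * coeff q i else 0)"
    by (simp add: coeff_sum)
  also have "\<dots> = (\<Sum>i<n. if i = (j + n - p) mod n then g * coeff q i else 0)"
  proof (intro sum.cong refl)
    fix i assume "i \<in> {..<n}"
    then have "(p + i) mod n = j \<longleftrightarrow> i = (j + n - p) mod n"
      using assms(1,3) by (auto simp: mod_if)
    then show "(if (p + i) mod n = j then g * coeff q i else 0)
        = (if i = (j + n - p) mod n then g * coeff q i else 0)" by simp
  qed
  also have "\<dots> = g * coeff q ((j + n - p) mod n)"
    using assms(1) by (simp add: sum.delta)
  finally show ?thesis .
qed

lemma coeff_col_poly:
  "j < dim_col M \<Longrightarrow> coeff (col_poly M j) i = (if i < dim_row M then M $$ (i, j) else 0)"
  by (simp add: col_poly_def coeff_Poly_eq nth_default_def)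

text \<open>The residue of \<open>- p\<close> modulo \<open>n\<close>: a filter \<open>X ^ e\<close>
  makes row \<open>i\<close> read row \<open>i - e\<close>, so reading row \<open>i + p\<close>
  needs this exponent.\<close>

definition shift_pos :: "nat \<Rightarrow> nat \<Rightarrow> nat" where
  "shift_pos n p = (n - p mod n) mod n"

lemma shift_pos: "0 < n \<Longrightarrow> shift_pos n p < n"
  "0 < n \<Longrightarrow> (i + n - shift_pos n p) mod n = (i + p) mod n"
proof -
  assume n: "0 < n"
  then show "shift_pos n p < n" by (simp add: shift_pos_def)
  show "(i + n - shift_pos n p) mod n = (i + p) mod n"
  proof (cases "p mod n = 0")
    case True
    then show ?thesis by (simp add: shift_pos_def) (metis add.right_neutral mod_add_right_eq)
  next
    case False
    then have "n - p mod n < n" using n by simp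
    then have "i + n - shift_pos n p = i + p mod n"
      using mod_less_divisor[OF n, of p] by (simp add: shift_pos_def del: mod_less_divisor)
    then show ?thesis by (simp add: mod_add_right_eq)
  qed
qed

definition flip_layer ::
  "nat \<Rightarrow> nat \<Rightarrow> nat \<Rightarrow> (nat \<Rightarrow> real) \<Rightarrow> (nat \<Rightarrow> real) \<Rightarrow> (nat \<Rightarrow> nat \<Rightarrow> real) \<Rightarrow>
    (nat \<Rightarrow> real) \<Rightarrow> (nat \<Rightarrow> nat) \<Rightarrow> (nat \<Rightarrow> nat \<Rightarrow> real) \<Rightarrow> layer" where
  "flip_layer n m s a b v g p w =
    \<lparr>width = 1, expansion = 1, weight = flip_mat m s a b,
     filter_mat = mat n m (\<lambda>(i, c). if i = shift_pos n (p c) then g c else 0),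
     bias1 = mat n m (\<lambda>(i, c). v i c), bias2 = mat n m (\<lambda>(i, c). w i c), kind = Circular\<rparr>"

lemma flip_layer_wf:
  "s < m \<Longrightarrow> layer_wf n (2 ^ m) (flip_layer n (2 ^ m) s a b v g p w)"
  using flip_mat_kaleidoscope[of s m a b] by (simp add: layer_wf_def flip_layer_def)

lemma mult_flip_mat:
  assumes "u \<in> carrier_mat n m" and "i < n" and "c < m" and "flip s c < m"
  shows "(u * flip_mat m s a b) $$ (i, c) = a c * u $$ (i, c) + b c * u $$ (i, flip s c)"
proof -
  have "(u * flip_mat m s a b) $$ (i, c)
      = (\<Sum>j = 0..<m. u $$ (i, j) * ((if j = c then a c else 0) + (if j = flip s c then b c else 0)))"
    using assms by (auto simp: flip_mat_def scalar_prod_def intro!: sum.cong)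
  also have "\<dots> = (\<Sum>j = 0..<m. (if j = c then a c * u $$ (i, c) else 0)
      + (if j = flip s c then b c * u $$ (i, flip s c) else 0))"
    by (intro sum.cong) (auto simp: algebra_simps)
  also have "\<dots> = a c * u $$ (i, c) + b c * u $$ (i, flip s c)"
    using assms by (subst sum.distrib) (simp add: algebra_simps)
  finally show ?thesis .
qed

lemma layer_apply_flip_layer:
  assumes u: "u \<in> carrier_mat n m" and n: "0 < n" and fl: "\<And>c. c < m \<Longrightarrow> flip s c < m"
  shows "layer_apply (flip_layer n m s a b v g p w) u = mat n m (\<lambda>(i, c).
    (a c * u $$ (i, c) + b c * u $$ (i, flip s c) + v i c) * (g c * u $$ ((i + p c) mod n, c) + w i c))"
    (is "layer_apply ?L u = _")
proof -
  have dims: "dim_row u = n" "dim_col u = m" using u by auto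
  have cv: "conv Circular (filter_mat ?L) u $$ (i, c) = g c * u $$ ((i + p c) mod n, c)"
    if "i < n" "c < m" for i c
  proof -
    have "col_poly (filter_mat ?L) c = monom (g c) (shift_pos n (p c))"
      using that shift_pos(1)[OF n, of "p c"] by (intro poly_eqI) (auto simp: coeff_col_poly flip_layer_def)
    then have "conv Circular (filter_mat ?L) u $$ (i, c)
        = coeff ((monom (g c) (shift_pos n (p c)) * col_poly u c) mod (monom 1 n - 1)) i"
      using that by (simp add: conv_def dims)
    also have "\<dots> = g c * coeff (col_poly u c) ((i + p c) mod n)"
      using coeff_monom_mult_mod_cyclic[OF shift_pos(1)[OF n], of "col_poly u c" i "g c" "p c"] that
      by (simp add: coeff_col_poly dims shift_pos(2)[OF n])
    finally show ?thesis using that n by (simp add: coeff_col_poly dims)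
  qed
  show ?thesis
  proof (rule eq_matI, goal_cases)
    case (1 i c)
    then have ic: "i < n" "c < m" by auto
    have "conv (kind ?L) (filter_mat ?L) u \<in> carrier_mat n m"
      by (simp add: conv_def dims)
    then show ?case
      using ic cv[OF ic] mult_flip_mat[OF u ic fl[OF ic(2)]]
      by (simp add: layer_apply_def hadamard_def dims flip_layer_def)
  qed (auto simp: layer_apply_def hadamard_def dims flip_layer_def flip_mat_def)
qed

section \<open>Straight-line programs that evaluate stacks of layers\<close>

definition computes :: "nat \<Rightarrow> nat \<Rightarrow> (real list \<Rightarrow> real) set \<Rightarrow> bool" where
  "computes n t F \<longleftrightarrow> (\<exists>p. length p \<le> t \<and> program_wf n p \<and>
     (\<forall>f\<in>F. \<exists>a<n + length p. \<forall>m. length m = n \<longrightarrow> run p m ! a = f m))"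

lemma computes_mono: "\<lbrakk>computes n t F; F' \<subseteq> F; t \<le> t'\<rbrakk> \<Longrightarrow> computes n t' F'"
  unfolding computes_def by (meson le_trans subsetD)

lemma run_snoc: "run (p @ [I]) m = run p m @ [instr_value (run p m) I]"
  by (simp add: run_def)

lemma length_run: "length (run p m) = length m + length p"
  by (induction p rule: rev_induct) (simp_all add: run_def)

lemma computes_input: "computes n 0 {\<lambda>m. m ! a |a. a < n}"
  unfolding computes_def by (rule exI[of _ "[]"]) (auto simp: program_wf_def run_def)

text \<open>The memory only grows, so old addresses keep their values and earlier results can be
  shared by all later instructions.\<close>

lemma computes_instr:
  assumes "computes n t F"
    and "\<And>p. \<lbrakk>program_wf n p; \<forall>f\<in>F. \<exists>a<n + length p. \<forall>m. length m = n \<longrightarrow> run p m ! a = f m\<rbrakk> \<Longrightarrow>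
      \<exists>I. operands I \<subseteq> {..<n + length p} \<and> (\<forall>m. length m = n \<longrightarrow> instr_value (run p m) I = f m)"
  shows "computes n (Suc t) (insert f F)"
proof -
  obtain p where p: "length p \<le> t" "program_wf n p"
    "\<forall>f\<in>F. \<exists>a<n + length p. \<forall>m. length m = n \<longrightarrow> run p m ! a = f m"
    using assms(1) unfolding computes_def by blast
  obtain I where I: "operands I \<subseteq> {..<n + length p}"
    "\<forall>m. length m = n \<longrightarrow> instr_value (run p m) I = f m"
    using assms(2)[OF p(2,3)] by blast
  have "program_wf n (p @ [I])"
    using p(2) I(1) by (auto simp: program_wf_def nth_append less_Suc_eq)
  moreover have "\<exists>a<n + length (p @ [I]). \<forall>m. length m = n \<longrightarrow> run (p @ [I]) m ! a = f' m"
    if "f' \<in> insert f F" for f'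
  proof (cases "f' = f")
    case True
    then show ?thesis using I(2)
      by (intro exI[of _ "n + length p"]) (auto simp: run_snoc nth_append length_run)
  next
    case False
    then have "f' \<in> F" using that by simp
    then obtain a where "a < n + length p" "\<forall>m. length m = n \<longrightarrow> run p m ! a = f' m"
      using p(3) by blast
    then show ?thesis by (intro exI[of _ a]) (auto simp: run_snoc nth_append length_run)
  qed
  ultimately show ?thesis
    using p(1) unfolding computes_def by (intro exI[of _ "p @ [I]"]) auto
qed

lemma computes_Load: "computes n t F \<Longrightarrow> computes n (Suc t) (insert (\<lambda>m. r) F)"
  by (erule computes_instr) (rule exI[of _ "Load r"], simp)

lemma computes_binop:
  assumes "computes n t F" and "f \<in> F" and "g \<in> F"
  shows computes_Add: "computes n (Suc t) (insert (\<lambda>m. f m + g m) F)"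
    and computes_Mul: "computes n (Suc t) (insert (\<lambda>m. f m * g m) F)"
proof -
  have *: "\<exists>a b. a < n + length p \<and> b < n + length p \<and>
      (\<forall>m. length m = n \<longrightarrow> run p m ! a = f m \<and> run p m ! b = g m)"
    if "\<forall>f\<in>F. \<exists>a<n + length p. \<forall>m. length m = n \<longrightarrow> run p m ! a = f m" for p
    using that assms(2,3) by (metis (no_types, lifting))
  show "computes n (Suc t) (insert (\<lambda>m. f m + g m) F)"
  proof (rule computes_instr[OF assms(1)])
    fix p assume "\<forall>f\<in>F. \<exists>a<n + length p. \<forall>m. length m = n \<longrightarrow> run p m ! a = f m"
    from *[OF this] obtain a b where "a < n + length p" "b < n + length p"
      "\<forall>m. length m = n \<longrightarrow> run p m ! a = f m \<and> run p m ! b = g m" by blast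
    then show "\<exists>I. operands I \<subseteq> {..<n + length p} \<and>
        (\<forall>m. length m = n \<longrightarrow> instr_value (run p m) I = f m + g m)"
      by (intro exI[of _ "Add a b"]) auto
  qed
  show "computes n (Suc t) (insert (\<lambda>m. f m * g m) F)"
  proof (rule computes_instr[OF assms(1)])
    fix p assume "\<forall>f\<in>F. \<exists>a<n + length p. \<forall>m. length m = n \<longrightarrow> run p m ! a = f m"
    from *[OF this] obtain a b where "a < n + length p" "b < n + length p"
      "\<forall>m. length m = n \<longrightarrow> run p m ! a = f m \<and> run p m ! b = g m" by blast
    then show "\<exists>I. operands I \<subseteq> {..<n + length p} \<and>
        (\<forall>m. length m = n \<longrightarrow> instr_value (run p m) I = f m * g m)"
      by (intro exI[of _ "Mul a b"]) auto
  qed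
qed

text \<open>The 12 instructions are five loads of parameters, four multiplications and three
  additions.\<close>

lemma computes_layer_entry:
  assumes "computes n t F" and "f1 \<in> F" and "f2 \<in> F" and "f3 \<in> F"
  shows "computes n (t + 12) (insert (\<lambda>m. (a * f1 m + b * f2 m + v) * (g * f3 m + w)) F)"
proof -
  note 1 = computes_Mul[OF computes_Load[OF assms(1), of a], of "\<lambda>_. a" f1]
  note 2 = computes_Mul[OF computes_Load[OF 1, of b], of "\<lambda>_. b" f2]
  note 3 = computes_Add[OF 2, of "\<lambda>m. a * f1 m" "\<lambda>m. b * f2 m"]
  note 4 = computes_Add[OF computes_Load[OF 3, of v], of "\<lambda>m. a * f1 m + b * f2 m" "\<lambda>_. v"]
  note 5 = computes_Mul[OF computes_Load[OF 4, of g], of "\<lambda>_. g" f3]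
  note 6 = computes_Add[OF computes_Load[OF 5, of w], of "\<lambda>m. g * f3 m" "\<lambda>_. w"]
  note 7 = computes_Mul[OF 6, of "\<lambda>m. a * f1 m + b * f2 m + v" "\<lambda>m. g * f3 m + w"]
  show ?thesis
    by (rule computes_mono[OF 7]) (use assms(2-4) in auto)
qed

text \<open>The premise allows any larger set \<open>F'\<close>, because the results for other
  indices have been stored in the meantime.\<close>

lemma computes_UN:
  assumes "finite I" and "computes n t F"
    and "\<And>F' t' x. \<lbrakk>x \<in> I; F \<subseteq> F'; computes n t' F'\<rbrakk> \<Longrightarrow> computes n (t' + k) (insert (G x) F')"
  shows "computes n (t + k * card I) (F \<union> G ` I)"
  using assms(1,3)
proof (induction I)
  case empty
  then show ?case using assms(2) by simp
next
  case (insert x I)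
  then have "computes n (t + k * card I) (F \<union> G ` I)" by simp
  then have "computes n (t + k * card I + k) (insert (G x) (F \<union> G ` I))"
    using insert.prems[of x "F \<union> G ` I"] by simp
  then show ?case using insert by (simp add: algebra_simps)
qed

definition entries :: "nat \<Rightarrow> nat \<Rightarrow> (real list \<Rightarrow> real mat) \<Rightarrow> (real list \<Rightarrow> real) set" where
  "entries n m U = (\<lambda>(i, c) l. U l $$ (i, c)) ` ({..<n} \<times> {..<m})"

text \<open>Each new entry depends on at most three old ones, so direct evaluation is linear in the
  size of the matrix and no fast Fourier transform or fast butterfly product is called for.\<close>

lemma computes_flip_layer:
  assumes "computes k t (entries n m U)" and "\<And>l. U l \<in> carrier_mat n m" and "0 < n"
    and fl: "\<And>c. c < m \<Longrightarrow> flip s c < m"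
  shows "computes k (t + 12 * (n * m)) (entries n m (\<lambda>l. layer_apply (flip_layer n m s a b v g p w) (U l)))"
proof -
  let ?G = "\<lambda>(i, c) l. layer_apply (flip_layer n m s a b v g p w) (U l) $$ (i, c)"
  have "computes k (t + 12 * card ({..<n} \<times> {..<m})) (entries n m U \<union> ?G ` ({..<n} \<times> {..<m}))"
  proof (rule computes_UN)
    fix F' t' x assume x: "x \<in> {..<n} \<times> {..<m}" and F': "entries n m U \<subseteq> F'" "computes k t' F'"
    obtain i c where ic: "x = (i, c)" "i < n" "c < m" using x by auto
    have mem: "(\<lambda>l. U l $$ (i, c)) \<in> F'" if "i < n" "c < m" for i c
      using F'(1) that by (force simp: entries_def)
    have "?G x = (\<lambda>l. (a c * U l $$ (i, c) + b c * U l $$ (i, flip s c) + v i c)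
        * (g c * U l $$ ((i + p c) mod n, c) + w i c))"
      using ic by (simp add: layer_apply_flip_layer[OF assms(2,3) fl])
    then show "computes k (t' + 12) (insert (?G x) F')"
      using computes_layer_entry[OF F'(2) mem mem mem] ic fl \<open>0 < n\<close> by simp
  qed (use assms(1) in auto)
  then show ?thesis
    by (rule computes_mono) (auto simp: entries_def)
qed

definition flip_layers :: "nat \<Rightarrow> nat \<Rightarrow> layer set" where
  "flip_layers n m = {flip_layer n (2 ^ m) s a b v g p w | s a b v g p w. s < m}"

lemma flip_lt: "\<lbrakk>s < m; c < 2 ^ m\<rbrakk> \<Longrightarrow> flip s c < 2 ^ m"
  using flip_lower(2) by blast

lemma layer_apply_carrier:
  assumes "L \<in> flip_layers n m" and "0 < n" and "u \<in> carrier_mat n (2 ^ m)"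
  shows "layer_apply L u \<in> carrier_mat n (2 ^ m)"
  using assms by (auto simp: flip_layers_def layer_apply_flip_layer flip_lt)

lemma computes_fold_layers:
  assumes "set Ls \<subseteq> flip_layers n m" and "0 < n"
    and "computes k t (entries n (2 ^ m) U)" and "\<And>l. U l \<in> carrier_mat n (2 ^ m)"
  shows "computes k (t + 12 * (n * 2 ^ m) * length Ls) (entries n (2 ^ m) (\<lambda>l. fold layer_apply Ls (U l)))"
  using assms
proof (induction Ls arbitrary: t U)
  case Nil
  then show ?case by simp
next
  case (Cons L Ls)
  have "computes k (t + 12 * (n * 2 ^ m)) (entries n (2 ^ m) (\<lambda>l. layer_apply L (U l)))"
    using Cons.prems by (auto simp: flip_layers_def intro!: computes_flip_layer flip_lt)
  from Cons.IH[OF _ _ this layer_apply_carrier] show ?case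
    using Cons.prems by (auto simp: algebra_simps)
qed

lemma length_concat_mat_to_list: "u \<in> carrier_mat n d \<Longrightarrow> length (concat (mat_to_list u)) = n * d"
  by (auto simp: mat_to_list_def length_concat o_def sum_list_triv)

lemma nth_concat_uniform:
  "\<lbrakk>\<forall>xs\<in>set xss. length xs = d; i < length xss; j < d\<rbrakk> \<Longrightarrow> concat xss ! (i * d + j) = xss ! i ! j"
proof (induction xss arbitrary: i)
  case (Cons xs xss)
  then show ?case by (cases i) (auto simp: nth_append)
qed simp

lemma nth_concat_mat_to_list:
  "\<lbrakk>u \<in> carrier_mat n d; i < n; j < d\<rbrakk> \<Longrightarrow> concat (mat_to_list u) ! (i * d + j) = u $$ (i, j)"
  by (subst nth_concat_uniform) (auto simp: mat_to_list_def)

lemma map_concat_mat_to_list: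
  "map f (concat (mat_to_list (mat n d h))) = concat (mat_to_list (mat n d (\<lambda>(i, c). f (h (i, c)))))"
  by (auto simp: mat_to_list_def map_concat intro!: arg_cong[of _ _ concat])

lemma baseconv_computable:
  assumes "layers T = Ls" "inner_rows T = n" "inner_cols T = 2 ^ m"
    and Ls: "set Ls \<subseteq> flip_layers n m" and n: "0 < n" and d: "d \<le> 2 ^ m"
  shows "computable_in_time n d (baseconv_apply T) (1 + 12 * (n * 2 ^ m) * length Ls)"
proof -
  define M where "M l = mat n d (\<lambda>(i, j). l ! (i * d + j))" for l :: "real list"
  let ?U = "\<lambda>l. resize n (2 ^ m) (M l)"
  \<comment> \<open>The one additional instruction loads the 0 used for all of the padding.\<close>
  have "computes (n * d) (Suc 0) (insert (\<lambda>l. 0) {\<lambda>l. l ! a |a. a < n * d})"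
    by (rule computes_Load[OF computes_input])
  moreover have "entries n (2 ^ m) ?U \<subseteq> insert (\<lambda>l. 0) {\<lambda>l. l ! a |a. a < n * d}"
  proof
    fix f assume "f \<in> entries n (2 ^ m) ?U"
    then obtain i c where ic: "i < n" "c < 2 ^ m" and f: "f = (\<lambda>l. ?U l $$ (i, c))"
      by (auto simp: entries_def)
    show "f \<in> insert (\<lambda>l. 0) {\<lambda>l. l ! a |a. a < n * d}"
    proof (cases "c < d")
      case True
      have "i * d + c < Suc i * d" using True by simp
      also have "\<dots> \<le> n * d" using ic by (intro mult_le_mono1) auto
      finally have "i * d + c < n * d" .
      then show ?thesis using ic True unfolding f by (auto simp: resize_def M_def)
    next
      case False
      then show ?thesis using ic unfolding f by (auto simp: resize_def M_def)
    qed
  qed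
  ultimately have "computes (n * d) (Suc 0) (entries n (2 ^ m) ?U)"
    using computes_mono by blast
  from computes_fold_layers[OF Ls n this]
  have "computes (n * d) (1 + 12 * (n * 2 ^ m) * length Ls) (entries n (2 ^ m) (\<lambda>l. fold layer_apply Ls (?U l)))"
    by (auto simp: resize_def)
  then obtain p where p: "length p \<le> 1 + 12 * (n * 2 ^ m) * length Ls" "program_wf (n * d) p"
    and e: "\<forall>f\<in>entries n (2 ^ m) (\<lambda>l. fold layer_apply Ls (?U l)).
      \<exists>a<n * d + length p. \<forall>l. length l = n * d \<longrightarrow> run p l ! a = f l"
    unfolding computes_def by blast
  have "\<exists>a<n * d + length p. \<forall>l. length l = n * d \<longrightarrow> run p l ! a = fold layer_apply Ls (?U l) $$ (i, c)"
    if "i < n" "c < d" for i c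
    using bspec[OF e, of "\<lambda>l. fold layer_apply Ls (?U l) $$ (i, c)"] that d by (force simp: entries_def)
  then obtain addr where addr: "\<And>i c. \<lbrakk>i < n; c < d\<rbrakk> \<Longrightarrow> addr i c < n * d + length p \<and>
      (\<forall>l. length l = n * d \<longrightarrow> run p l ! addr i c = fold layer_apply Ls (?U l) $$ (i, c))"
    by metis
  define outs where "outs = concat (mat_to_list (mat n d (\<lambda>(i, c). addr i c)))"
  have "set outs \<subseteq> {..<n * d + length p}"
    using addr by (auto simp: outs_def mat_to_list_def)
  moreover have "map (\<lambda>a. run p (concat (mat_to_list u)) ! a) outs
      = concat (mat_to_list (baseconv_apply T u))" if u: "u \<in> carrier_mat n d" for u
  proof -
    let ?l = "concat (mat_to_list u)"
    have len: "length ?l = n * d" by (rule length_concat_mat_to_list[OF u])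
    have Ml: "M ?l = u"
      using u by (intro eq_matI) (auto simp: M_def nth_concat_mat_to_list)
    have "fold layer_apply Ls v \<in> carrier_mat n (2 ^ m)" if "v \<in> carrier_mat n (2 ^ m)" for v
      using that Ls by (induction Ls arbitrary: v) (auto intro!: layer_apply_carrier[OF _ n])
    then have "fold layer_apply Ls (?U ?l) \<in> carrier_mat n (2 ^ m)"
      by (simp add: resize_def)
    then have "dim_row (fold layer_apply Ls (?U ?l)) = n" "dim_col (fold layer_apply Ls (?U ?l)) = 2 ^ m"
      by auto
    then have "baseconv_apply T u = mat n d (\<lambda>(i, c). fold layer_apply Ls (?U ?l) $$ (i, c))"
      using u d assms(1-3) unfolding Ml
      by (intro eq_matI) (auto simp: baseconv_apply_def resize_def[of n d])
    also have "\<dots> = mat n d (\<lambda>(i, c). run p ?l ! addr i c)"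
      by (rule cong_mat) (use addr len in auto)
    finally show ?thesis
      unfolding outs_def map_concat_mat_to_list by simp
  qed
  ultimately show ?thesis
    unfolding computable_in_time_def using p by blast
qed

section \<open>Registers and the lexicographic comparison of rows\<close>

text \<open>The columns are split into four registers of \<open>2 ^ k\<close> columns each. A step
  \<open>Step s r a b v g p w\<close> is a layer that changes register \<open>r\<close> only: its first factor is
  \<open>a x + b x' + v\<close>, where \<open>x'\<close> is the entry in the column that differs from the column of \<open>x\<close>
  in bit \<open>s\<close> (for \<open>s \<ge> k\<close> it lies in another register), and its second factor is \<open>g\<close> times the
  column rotated by \<open>p\<close> rows, plus \<open>w\<close>.\<close>

datatype step = Step (exch_bit: nat) nat "nat \<Rightarrow> real" "nat \<Rightarrow> real" "nat \<Rightarrow> nat \<Rightarrow> real"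
  "nat \<Rightarrow> real" "nat \<Rightarrow> nat" "nat \<Rightarrow> nat \<Rightarrow> real"

text \<open>Without the case \<open>p = 0\<close>, an unrotated read would still reduce the row
  number modulo \<open>n\<close>. With it, the semantics of unrotated steps are equations between
  functions, valid for rows \<open>i \<ge> n\<close> as well.\<close>

definition rotate_rows :: "nat \<Rightarrow> nat \<Rightarrow> (nat \<Rightarrow> nat \<Rightarrow> real) \<Rightarrow> nat \<Rightarrow> nat \<Rightarrow> real" where
  "rotate_rows n p X i = (if p = 0 then X i else X ((i + p) mod n))"

fun step_sem :: "nat \<Rightarrow> nat \<Rightarrow> step \<Rightarrow> (nat \<Rightarrow> nat \<Rightarrow> nat \<Rightarrow> real) \<Rightarrow> nat \<Rightarrow> nat \<Rightarrow> nat \<Rightarrow> real" where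
  "step_sem n k (Step s r a b v g p w) A = A(r := \<lambda>i l.
     (a l * A r i l + b l * (if s < k then A r i (flip s l) else A (flip (s - k) r) i l) + v i l)
     * (g l * rotate_rows n (p l) (A r) i l + w i l))"

text \<open>On the other registers the first factor is the entry itself and the second factor is 1,
  so the layer preserves them.\<close>

fun compile :: "nat \<Rightarrow> nat \<Rightarrow> step \<Rightarrow> layer" where
  "compile n k (Step s r a b v g p w) = flip_layer n (2 ^ (k + 2)) s
     (\<lambda>c. if c div 2 ^ k = r then a (c mod 2 ^ k) else 1)
     (\<lambda>c. if c div 2 ^ k = r then b (c mod 2 ^ k) else 0)
     (\<lambda>i c. if c div 2 ^ k = r then v i (c mod 2 ^ k) else 0)
     (\<lambda>c. if c div 2 ^ k = r then g (c mod 2 ^ k) else 0)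
     (\<lambda>c. p (c mod 2 ^ k))
     (\<lambda>i c. if c div 2 ^ k = r then w i (c mod 2 ^ k) else 1)"

definition pack :: "nat \<Rightarrow> nat \<Rightarrow> (nat \<Rightarrow> nat \<Rightarrow> nat \<Rightarrow> real) \<Rightarrow> real mat" where
  "pack n k A = mat n (2 ^ (k + 2)) (\<lambda>(i, c). A (c div 2 ^ k) i (c mod 2 ^ k))"

lemma flip_div_mod:
  shows "s < k \<Longrightarrow> flip s c div 2 ^ k = c div 2 ^ k" and "s < k \<Longrightarrow> flip s c mod 2 ^ k = flip s (c mod 2 ^ k)"
    and "\<not> s < k \<Longrightarrow> flip s c div 2 ^ k = flip (s - k) (c div 2 ^ k)"
    and "\<not> s < k \<Longrightarrow> flip s c mod 2 ^ k = c mod 2 ^ k"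
proof -
  have l: "c mod 2 ^ k < 2 ^ k" by simp
  have c: "c div 2 ^ k * 2 ^ k + c mod 2 ^ k = c" by (rule div_mult_mod_eq)
  show "flip s c div 2 ^ k = c div 2 ^ k" "flip s c mod 2 ^ k = flip s (c mod 2 ^ k)" if "s < k"
    using flip_lower(1)[OF l that, of "c div 2 ^ k"] flip_lower(2)[OF l that] unfolding c by simp_all
  show "flip s c div 2 ^ k = flip (s - k) (c div 2 ^ k)" "flip s c mod 2 ^ k = c mod 2 ^ k" if "\<not> s < k"
  proof -
    have "flip s c = flip (s - k) (c div 2 ^ k) * 2 ^ k + c mod 2 ^ k"
      using flip_add[OF l, of "s - k" "c div 2 ^ k"] that unfolding c by simp
    then show "flip s c div 2 ^ k = flip (s - k) (c div 2 ^ k)" "flip s c mod 2 ^ k = c mod 2 ^ k"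
      by simp_all
  qed
qed

lemma layer_apply_compile:
  assumes "0 < n" and "exch_bit S < k + 2"
  shows "layer_apply (compile n k S) (pack n k A) = pack n k (step_sem n k S A)"
proof (cases S)
  case (Step s r a b v g p w)
  have fl: "flip s c < 2 ^ (k + 2)" if "c < 2 ^ (k + 2)" for c
    using flip_lt[of s "k + 2" c] assms(2) that Step by simp
  show ?thesis
    unfolding Step compile.simps
    by (subst layer_apply_flip_layer[OF _ assms(1) fl])
      (use assms(1) fl in \<open>auto simp: pack_def flip_div_mod rotate_rows_def\<close>)
qed

lemma fold_layer_apply_compile:
  assumes "0 < n" and "\<forall>S\<in>set Ss. exch_bit S < k + 2"
  shows "fold layer_apply (map (compile n k) Ss) (pack n k A) = pack n k (fold (step_sem n k) Ss A)"
  using assms(2) by (induction Ss arbitrary: A) (auto simp: layer_apply_compile[OF assms(1)])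

lemma compile_flip_layers: "exch_bit S < k + 2 \<Longrightarrow> compile n k S \<in> flip_layers n (k + 2)"
  by (cases S) (auto simp: flip_layers_def intro!: exI)

text \<open>The two factors of a layer are specialised in four ways: a second factor 1 leaves an
  affine map, a first factor 1 leaves a rotation, the entry itself as second factor gives genuine
  products, and a bias as second factor gives a mask depending on the row.\<close>

definition lin :: "nat \<Rightarrow> nat \<Rightarrow> (nat \<Rightarrow> real) \<Rightarrow> (nat \<Rightarrow> real) \<Rightarrow> (nat \<Rightarrow> nat \<Rightarrow> real) \<Rightarrow> step" where
  "lin s r a b v = Step s r a b v (\<lambda>_. 0) (\<lambda>_. 0) (\<lambda>_ _. 1)"

definition mul :: "nat \<Rightarrow> nat \<Rightarrow> real \<Rightarrow> real \<Rightarrow> real \<Rightarrow> step" where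
  "mul s r a b v = Step s r (\<lambda>_. a) (\<lambda>_. b) (\<lambda>_ _. v) (\<lambda>_. 1) (\<lambda>_. 0) (\<lambda>_ _. 0)"

definition rot :: "nat \<Rightarrow> (nat \<Rightarrow> nat) \<Rightarrow> step" where
  "rot r p = Step 0 r (\<lambda>_. 0) (\<lambda>_. 0) (\<lambda>_ _. 1) (\<lambda>_. 1) p (\<lambda>_ _. 0)"

definition scale :: "nat \<Rightarrow> real \<Rightarrow> (nat \<Rightarrow> real) \<Rightarrow> step" where
  "scale r v w = Step 0 r (\<lambda>_. 1) (\<lambda>_. 0) (\<lambda>_ _. v) (\<lambda>_. 0) (\<lambda>_. 0) (\<lambda>i _. w i)"

lemma step_sem_simps [simp]:
  "step_sem n k (lin s r a b v) A = A(r := \<lambda>i l. a l * A r i l +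
     b l * (if s < k then A r i (flip s l) else A (flip (s - k) r) i l) + v i l)"
  "step_sem n k (mul s r a' b' v') A = A(r := \<lambda>i l. (a' * A r i l +
     b' * (if s < k then A r i (flip s l) else A (flip (s - k) r) i l) + v') * A r i l)"
  "step_sem n k (rot r p) A = A(r := \<lambda>i l. rotate_rows n (p l) (A r) i l)"
  "step_sem n k (scale r v' w) A = A(r := \<lambda>i l. (A r i l + v') * w i)"
  by (simp_all add: lin_def mul_def rot_def scale_def rotate_rows_def)

lemma exch_bit_simps [simp]:
  "exch_bit (lin s r a b v) = s" "exch_bit (mul s r a' b' v') = s" "exch_bit (rot r p) = 0"
  "exch_bit (scale r v' w) = 0"
  by (simp_all add: lin_def mul_def rot_def scale_def)

declare step_sem.simps [simp del]

text \<open>The sign of the first non-zero entry of a sequence over \<open>{- 1, 0, 1}\<close> is the product of its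
  entries under this operation. Applied to the difference of two rows of bits it compares them
  lexicographically.\<close>

definition comb :: "real \<Rightarrow> real \<Rightarrow> real" where
  "comb x y = x + y - x * x * y"

text \<open>Both columns of a pair receive the same value, with the arguments in column order since
  \<open>comb\<close> is not commutative. Thus the reduction also broadcasts: in the end each column
  holds the sign and can serve as a mask.\<close>

definition comb_level :: "nat \<Rightarrow> (nat \<Rightarrow> nat \<Rightarrow> real) \<Rightarrow> nat \<Rightarrow> nat \<Rightarrow> real" where
  "comb_level s X i l = (if even (l div 2 ^ s) then comb (X i l) (X i (flip s l))
     else comb (X i (flip s l)) (X i l))"

text \<open>With \<open>x\<close> in the even and \<open>y\<close> in the odd column of a pair,
  register 2 is scratch space for \<open>x * x * y\<close>: it is correct in the even column after
  the two products and is then copied to the odd one. Register 3 becomes \<open>x + y\<close> minus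
  this.\<close>

definition comb_steps :: "nat \<Rightarrow> nat \<Rightarrow> step list" where
  "comb_steps k s = [lin k 2 (\<lambda>_. 0) (\<lambda>_. 1) (\<lambda>_ _. 0), mul s 2 0 1 0, mul k 2 0 1 0,
     lin s 2 (\<lambda>l. if even (l div 2 ^ s) then 1 else 0) (\<lambda>l. if even (l div 2 ^ s) then 0 else 1) (\<lambda>_ _. 0),
     lin s 3 (\<lambda>_. 1) (\<lambda>_. 1) (\<lambda>_ _. 0), lin k 3 (\<lambda>_. 1) (\<lambda>_. - 1) (\<lambda>_ _. 0)]"

lemma flip_flip [simp]: "flip s (flip s l) = l"
proof -
  define q i where "q = l div 2 ^ Suc s" and "i = l mod 2 ^ Suc s"
  have l: "l = q * 2 ^ Suc s + i" and i: "i < 2 ^ Suc s"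
    by (auto simp only: q_def i_def div_mult_mod_eq intro!: mod_less_divisor zero_less_power)
  have j: "(if i < 2 ^ s then i + 2 ^ s else i - 2 ^ s) < 2 ^ Suc s" using i by auto
  show ?thesis unfolding l flip_block[OF i] flip_block[OF j] using i by auto
qed

lemma fold_comb_steps:
  assumes "s < k"
  shows "\<exists>J. fold (step_sem n k) (comb_steps k s) A = A(2 := J, 3 := comb_level s (A 3))"
proof (intro exI ext)
  fix r i l
  show "fold (step_sem n k) (comb_steps k s) A r i l
    = (A(2 := fold (step_sem n k) (comb_steps k s) A 2, 3 := comb_level s (A 3))) r i l"
    using assms
    by (cases "r = 2"; cases "r = 3") (simp_all add: comb_steps_def comb_level_def comb_def algebra_simps)
qed

definition reduce_steps :: "nat \<Rightarrow> step list" where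
  "reduce_steps k = concat (map (comb_steps k) [0..<k])"

lemma fold_reduce_steps:
  "\<exists>J. fold (step_sem n k) (reduce_steps k) A = A(2 := J, 3 := fold comb_level [0..<k] (A 3))"
proof -
  have "\<exists>J. fold (step_sem n k) (concat (map (comb_steps k) [0..<s])) A
      = A(2 := J, 3 := fold comb_level [0..<s] (A 3))" if "s \<le> k" for s
    using that
  proof (induction s)
    case 0
    then show ?case by (auto intro!: exI[of _ "A 2"])
  next
    case (Suc s)
    then obtain J where J: "fold (step_sem n k) (concat (map (comb_steps k) [0..<s])) A
      = A(2 := J, 3 := fold comb_level [0..<s] (A 3))" by fastforce
    obtain J' where "fold (step_sem n k) (comb_steps k s) (A(2 := J, 3 := fold comb_level [0..<s] (A 3)))
      = (A(2 := J, 3 := fold comb_level [0..<s] (A 3)))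
          (2 := J', 3 := comb_level s ((A(2 := J, 3 := fold comb_level [0..<s] (A 3))) 3))"
      using fold_comb_steps Suc.prems by (metis Suc_le_eq)
    then show ?case using J by (auto simp: fun_upd_twist intro!: exI[of _ J'])
  qed
  then show ?thesis by (simp add: reduce_steps_def)
qed

section \<open>Tree reduction as comparison of binary numbers\<close>

fun block_comb :: "nat \<Rightarrow> (nat \<Rightarrow> real) \<Rightarrow> nat \<Rightarrow> real" where
  "block_comb 0 e q = e q"
| "block_comb (Suc s) e q = comb (block_comb s e (2 * q)) (block_comb s e (2 * q + 1))"

lemma div_power_Suc: "(l::nat) div 2 ^ Suc s = l div 2 ^ s div 2"
  by (metis div_mult2_eq power_Suc2)

text \<open>After \<open>s\<close> levels, a column holds the combination over the aligned block of
  \<open>2 ^ s\<close> columns that contains it.\<close>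

lemma fold_comb_level: "fold comb_level [0..<s] X i l = block_comb s (X i) (l div 2 ^ s)"
proof (induction s arbitrary: l)
  case (Suc s)
  note div = div_power_Suc[of l s]
  show ?case
  proof (cases "even (l div 2 ^ s)")
    case True
    then have "l div 2 ^ s = 2 * (l div 2 ^ Suc s)" unfolding div by simp
    moreover have "flip s l div 2 ^ s = l div 2 ^ s + 1" using True by (simp add: flip_def)
    ultimately show ?thesis using True Suc.IH by (simp add: comb_level_def del: power_Suc)
  next
    case False
    then have "l div 2 ^ s = 2 * (l div 2 ^ Suc s) + 1" unfolding div by simp
    moreover have "flip s l div 2 ^ s = l div 2 ^ s - 1"
    proof -
      \<comment> \<open>The bit is set, so the subtraction in \<open>flip\<close> is not
        truncated.\<close>
      have "2 ^ s \<le> l" using False by (metis div_less even_zero not_le)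
      then have "l = (l - 2 ^ s) + 2 ^ s" by simp
      then have "l div 2 ^ s = (l - 2 ^ s) div 2 ^ s + 1" by (metis div_add_self2 power_not_zero zero_neq_numeral)
      then show ?thesis using False by (simp add: flip_def)
    qed
    ultimately show ?thesis using False Suc.IH by (simp add: comb_level_def del: power_Suc)
  qed
qed simp

text \<open>Binary number formed by the columns of a block, leftmost column most significant; hence
  the base \<open>2 ^ 2 ^ s\<close> for halves of \<open>2 ^ s\<close> bits. It turns rows into the
  natural numbers that the sorting network orders.\<close>

fun block_val :: "nat \<Rightarrow> (nat \<Rightarrow> real) \<Rightarrow> nat \<Rightarrow> nat" where
  "block_val 0 e q = (if e q = 1 then 1 else 0)"
| "block_val (Suc s) e q = block_val s e (2 * q) * 2 ^ 2 ^ s + block_val s e (2 * q + 1)"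

lemma lex_less:
  assumes "y < B" and "y' < (B::nat)"
  shows "x * B + y < x' * B + y' \<longleftrightarrow> x < x' \<or> x = x' \<and> y < y'"
proof -
  have "x * B + y < x' * B + y'" if "x < x'" "y < B" for x x' y y'
  proof -
    have "x * B + y < (x + 1) * B" using that by simp
    also have "\<dots> \<le> x' * B" using that by (intro mult_le_mono1) auto
    finally show ?thesis by simp
  qed
  from this[of x x' y y'] this[of x' x y' y] assms show ?thesis by (cases x x' rule: linorder_cases) auto
qed

lemma block_val_less: "block_val s e q < 2 ^ 2 ^ s"
proof (induction s arbitrary: q)
  case (Suc s)
  have "block_val (Suc s) e q < (block_val s e (2 * q) + 1) * 2 ^ 2 ^ s" using Suc by simp
  also have "\<dots> \<le> 2 ^ 2 ^ s * 2 ^ 2 ^ s" using Suc[of "2 * q"] by (intro mult_le_mono1) auto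
  finally show ?case by (simp flip: power_add add: mult_2)
qed simp

lemma block_val_Suc_less:
  "block_val (Suc s) e q < block_val (Suc s) e' q' \<longleftrightarrow>
    block_val s e (2 * q) < block_val s e' (2 * q') \<or>
    block_val s e (2 * q) = block_val s e' (2 * q') \<and> block_val s e (2 * q + 1) < block_val s e' (2 * q' + 1)"
  by (simp add: lex_less[OF block_val_less block_val_less])

definition cmp :: "nat \<Rightarrow> nat \<Rightarrow> real" where
  "cmp x y = (if x < y then - 1 else if x = y then 0 else 1)"

text \<open>\<open>comb\<close> keeps the left sign unless it is 0, just as two-digit numbers are
  compared by the leading digit first.\<close>

lemma block_comb_diff:
  assumes "\<And>l. l div 2 ^ s = q \<Longrightarrow> e l \<in> {0, 1} \<and> e' l \<in> {0, 1}"
  shows "block_comb s (\<lambda>l. e l - e' l) q = cmp (block_val s e q) (block_val s e' q)"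
  using assms
proof (induction s arbitrary: q)
  case 0
  from 0[of q] show ?case by (auto simp: cmp_def)
next
  case (Suc s)
  note div = div_power_Suc[of _ s]
  have *: "block_comb s (\<lambda>l. e l - e' l) (2 * q + b) = cmp (block_val s e (2 * q + b)) (block_val s e' (2 * q + b))"
    if "b < 2" for b
    by (rule Suc.IH, rule Suc.prems) (use that in \<open>simp add: div del: power_Suc\<close>)
  show ?case
    using *[of 0] *[of 1] block_val_Suc_less[of s e q e' q] block_val_Suc_less[of s e' q e q]
    unfolding cmp_def comb_def block_comb.simps
    by (auto simp del: block_val.simps split: if_splits)
qed

lemma block_val_eq_iff:
  assumes "\<And>l. l div 2 ^ s = q \<Longrightarrow> e l \<in> {0, 1} \<and> e' l \<in> {0, 1}"
  shows "block_val s e q = block_val s e' q \<longleftrightarrow> (\<forall>l. l div 2 ^ s = q \<longrightarrow> e l = e' l)"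
  using assms
proof (induction s arbitrary: q)
  case 0
  from 0[of q] show ?case by auto
next
  case (Suc s)
  note div = div_power_Suc[of _ s]
  have *: "block_val s e (2 * q + b) = block_val s e' (2 * q + b) \<longleftrightarrow>
      (\<forall>l. l div 2 ^ s = 2 * q + b \<longrightarrow> e l = e' l)" if "b < 2" for b
    by (rule Suc.IH, rule Suc.prems) (use that in \<open>simp add: div del: power_Suc\<close>)
  have "l div 2 ^ Suc s = q \<longleftrightarrow> l div 2 ^ s = 2 * q \<or> l div 2 ^ s = 2 * q + 1" for l
    unfolding div by auto
  moreover have "block_val (Suc s) e q = block_val (Suc s) e' q \<longleftrightarrow>
      block_val s e (2 * q) = block_val s e' (2 * q) \<and> block_val s e (2 * q + 1) = block_val s e' (2 * q + 1)"
    using block_val_Suc_less[of s e q e' q] block_val_Suc_less[of s e' q e q] by (metis block_val.simps(2) less_irrefl linorder_less_linear)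
  ultimately show ?case using *[of 0] *[of 1] by auto
qed

section \<open>Sorting rows\<close>

text \<open>With \<open>S i = 1\<close> if rows \<open>i\<close> and \<open>i + h\<close> have to be swapped and \<open>S i = 0\<close> otherwise, and
  \<open>Z i = S i * (X i - X (i + h))\<close>, the new rows are \<open>X i - Z i + Z (i - h)\<close>.\<close>

definition pass_steps :: "nat \<Rightarrow> nat \<Rightarrow> nat \<Rightarrow> step list" where
  "pass_steps n k h =
    [lin k 1 (\<lambda>_. 0) (\<lambda>_. 1) (\<lambda>_ _. 0), rot 1 (\<lambda>_. h), lin k 1 (\<lambda>_. - 1) (\<lambda>_. 1) (\<lambda>_ _. 0),
     lin (k + 1) 3 (\<lambda>_. 0) (\<lambda>_. 1) (\<lambda>_ _. 0)] @ reduce_steps k @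
    [mul 0 3 1 0 1, scale 3 0 (\<lambda>i. if i + h < n then 1 / 2 else 0), mul (k + 1) 1 0 1 0,
     lin k 0 (\<lambda>_. 1) (\<lambda>_. - 1) (\<lambda>_ _. 0), rot 1 (\<lambda>_. n - h), lin k 0 (\<lambda>_. 1) (\<lambda>_. 1) (\<lambda>_ _. 0)]"

text \<open>For a sign \<open>S\<close>, \<open>(S + 1) * S / 2\<close> is 1 if \<open>S = 1\<close>
  and 0 if \<open>S\<close> is 0 or \<open>- 1\<close>. Replacing \<open>1 / 2\<close> by 0 for
  \<open>i + h \<ge> n\<close> discards the pairs that the circular shift creates by wrapping
  around; the rotation by \<open>n - h\<close> reads row \<open>i - h\<close>.\<close>

lemma fold_pass_steps:
  fixes A :: "nat \<Rightarrow> nat \<Rightarrow> nat \<Rightarrow> real" and n k h :: nat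
  assumes "0 < h" and "h < n"
  defines "E \<equiv> \<lambda>i l. A 0 i l - A 0 ((i + h) mod n) l"
  defines "S \<equiv> fold comb_level [0..<k] E"
  defines "Z \<equiv> \<lambda>i l. (S i l + 1) * S i l * (if i + h < n then 1 / 2 else 0) * E i l"
  shows "fold (step_sem n k) (pass_steps n k h) A 0 i l = A 0 i l - Z i l + Z ((i + (n - h)) mod n) l"
proof -
  let ?s1 = "[lin k 1 (\<lambda>_. 0) (\<lambda>_. 1) (\<lambda>_ _. 0), rot 1 (\<lambda>_. h), lin k 1 (\<lambda>_. - 1) (\<lambda>_. 1) (\<lambda>_ _. 0),
     lin (k + 1) 3 (\<lambda>_. 0) (\<lambda>_. 1) (\<lambda>_ _. 0)]"
  have 1: "fold (step_sem n k) ?s1 A = A(1 := E, 3 := E)"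
    using assms(1) by (simp add: E_def fun_eq_iff rotate_rows_def)
  obtain J where J: "fold (step_sem n k) (reduce_steps k) (A(1 := E, 3 := E))
      = (A(1 := E, 3 := E))(2 := J, 3 := S)"
    using fold_reduce_steps[of n k "A(1 := E, 3 := E)"] by (auto simp: S_def)
  show ?thesis
    unfolding pass_steps_def fold_append comp_apply 1 J
    using assms(1,2) by (simp add: Z_def rotate_rows_def)
qed

lemma block_val_cong:
  assumes "\<And>j. j < 2 ^ s \<Longrightarrow> e (q * 2 ^ s + j) = e' (q' * 2 ^ s + j)"
  shows "block_val s e q = block_val s e' q'"
  using assms
proof (induction s arbitrary: q q')
  case 0
  from 0[of 0] show ?case by simp
next
  case (Suc s)
  have "block_val s e (2 * q) = block_val s e' (2 * q')"
    by (rule Suc.IH) (use Suc.prems in \<open>simp add: algebra_simps\<close>)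
  moreover have "block_val s e (2 * q + 1) = block_val s e' (2 * q' + 1)"
  proof (rule Suc.IH)
    fix j :: nat assume "j < 2 ^ s"
    then show "e ((2 * q + 1) * 2 ^ s + j) = e' ((2 * q' + 1) * 2 ^ s + j)"
      using Suc.prems[of "2 ^ s + j"] by (simp add: algebra_simps)
  qed
  ultimately show ?case by simp
qed

lemma block_val_cong_0: "(\<And>j. j < 2 ^ s \<Longrightarrow> e j = e' j) \<Longrightarrow> block_val s e 0 = block_val s e' 0"
  by (rule block_val_cong) simp

lemma div_power_eq_0: "(l::nat) div 2 ^ k = 0 \<longleftrightarrow> l < 2 ^ k"
  by (simp add: div_eq_0_iff)

lemma fold_pass_steps_exchange:
  fixes A :: "nat \<Rightarrow> nat \<Rightarrow> nat \<Rightarrow> real" and k :: nat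
  defines "V \<equiv> \<lambda>i. block_val k (A 0 i) 0"
  assumes h: "0 < h" "h < n" and bits: "\<And>i l. \<lbrakk>i < n; l < 2 ^ k\<rbrakk> \<Longrightarrow> A 0 i l \<in> {0, 1}"
    and ord: "h_ordered n V (2 * h)" and i: "i < n" and l: "l < 2 ^ k"
  shows "fold (step_sem n k) (pass_steps n k h) A 0 i l = A 0 (exchange n h V i) l"
proof -
  define E where "E = (\<lambda>i l. A 0 i l - A 0 ((i + h) mod n) l)"
  define S where "S = fold comb_level [0..<k] E"
  define Z where "Z = (\<lambda>i l. (S i l + 1) * S i l * (if i + h < n then 1 / 2 else 0) * E i l)"
  have S: "S i l = cmp (V i) (V ((i + h) mod n))" if "i < n" for i
  proof -
    have "S i l = block_comb k (E i) 0"
      using l by (simp add: S_def fold_comb_level)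
    also have "\<dots> = cmp (V i) (V ((i + h) mod n))"
      unfolding E_def V_def
    proof (rule block_comb_diff)
      have "(i + h) mod n < n" using h by simp
      then show "A 0 i l \<in> {0, 1} \<and> A 0 ((i + h) mod n) l \<in> {0, 1}" if "l div 2 ^ k = 0" for l
        using bits \<open>i < n\<close> that unfolding div_power_eq_0 by blast
    qed
    finally show ?thesis .
  qed
  have Z: "Z i l = (if i + h < n \<and> V (i + h) < V i then A 0 i l - A 0 (i + h) l else 0)" if "i < n" for i
    using S[OF that] that by (auto simp: Z_def E_def cmp_def)
  have prev: "(i + (n - h)) mod n = (if h \<le> i then i - h else i + n - h)"
    using i h by (auto simp: mod_if)
  \<comment> \<open>For \<open>i < h\<close> the rotation wraps to row \<open>i + n - h\<close>,
    whose partner would be beyond the end, so its mask is 0.\<close>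
  have "Z ((i + (n - h)) mod n) l = (if h \<le> i \<and> V i < V (i - h) then A 0 (i - h) l - A 0 i l else 0)"
    unfolding prev using Z[of "i - h"] Z[of "i + n - h"] i h by auto
  moreover have "fold (step_sem n k) (pass_steps n k h) A 0 i l = A 0 i l - Z i l + Z ((i + (n - h)) mod n) l"
    unfolding Z_def S_def E_def by (rule fold_pass_steps[OF h])
  \<comment> \<open>This excludes that both corrections apply to row \<open>i\<close>.\<close>
  moreover have "V (i - h) \<le> V (i + h)" if "h \<le> i" "i + h < n"
    using ord that unfolding h_ordered_def by (auto dest!: spec[of _ "i - h"] simp: add.commute)
  ultimately show ?thesis
    using Z[OF i] by (auto simp: exchange_def)
qed

definition sort_steps :: "nat \<Rightarrow> nat \<Rightarrow> nat \<Rightarrow> step list" where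
  "sort_steps n k m = concat (map (pass_steps n k) (filter (\<lambda>h. h < n) (pratt m)))"

text \<open>The invariant tracks a permutation of whole rows of register 0, not merely of keys, so
  that payloads travel with their keys; the other registers are scratch space.\<close>

lemma fold_sort_steps:
  fixes A :: "nat \<Rightarrow> nat \<Rightarrow> nat \<Rightarrow> real" and k :: nat
  defines "V \<equiv> \<lambda>i. block_val k (A 0 i) 0"
  assumes n: "n \<le> 2 ^ m" and bits: "\<And>i l. \<lbrakk>i < n; l < 2 ^ k\<rbrakk> \<Longrightarrow> A 0 i l \<in> {0, 1}"
  shows "\<exists>\<pi>. bij_betw \<pi> {..<n} {..<n} \<and> (\<forall>i<n. \<forall>l<2 ^ k. fold (step_sem n k) (sort_steps n k m) A 0 i l = A 0 (\<pi> i) l)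
     \<and> (\<forall>i j. i \<le> j \<longrightarrow> j < n \<longrightarrow> V (\<pi> i) \<le> V (\<pi> j))"
proof -
  define R where "R B v \<longleftrightarrow> (\<exists>\<pi>. bij_betw \<pi> {..<n} {..<n} \<and> v = V \<circ> \<pi> \<and>
    (\<forall>i<n. \<forall>l<2 ^ k. B 0 i l = A 0 (\<pi> i) l))" for B :: "nat \<Rightarrow> nat \<Rightarrow> nat \<Rightarrow> real" and v
  define f where "f h = (if h < n then fold (step_sem n k) (pass_steps n k h) else id)" for h
  have "\<exists>v. R (fold f (pratt m) A) v \<and> h_ordered n v 1"
  proof (rule pratt_induct[where R = R and s = A and v = V and f = f, OF _ n])
    show "R A V" unfolding R_def by (intro exI[of _ id]) auto
    fix h B v assume h: "h \<in> set (pratt m)" and RB: "R B v" and ord: "h_ordered n v (2 * h)"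
    obtain \<pi> where p: "bij_betw \<pi> {..<n} {..<n}" "v = V \<circ> \<pi>"
      and row: "\<And>i l. \<lbrakk>i < n; l < 2 ^ k\<rbrakk> \<Longrightarrow> B 0 i l = A 0 (\<pi> i) l"
      using RB unfolding R_def by blast
    show "R (f h B) (shell_step n h v)"
    proof (cases "h < n")
      case False
      then show ?thesis using RB by (simp add: f_def shell_step_def)
    next
      case True
      have lt: "\<pi> i < n" if "i < n" for i using p(1) that by (auto simp: bij_betw_def)
      let ?V = "\<lambda>i. block_val k (B 0 i) 0"
      have V: "?V i = v i" if "i < n" for i
        unfolding p(2) comp_apply V_def by (rule block_val_cong_0) (use row that in auto)
      have ord': "h_ordered n ?V (2 * h)" using ord V by (auto simp: h_ordered_def)
      have ex: "exchange n h ?V i = exchange n h v i" if "i < n" for i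
        using that V by (auto simp: exchange_def)
      have "f h B 0 i l = A 0 ((\<pi> \<circ> exchange n h v) i) l" if "i < n" "l < 2 ^ k" for i l
      proof -
        have "f h B 0 i l = B 0 (exchange n h ?V i) l"
          using fold_pass_steps_exchange[of h n k B i l, OF pratt_pos[OF h] True _ ord' that] row lt bits True
          by (simp add: f_def)
        moreover have "exchange n h v i < n" using that by (auto simp: exchange_def)
        ultimately show ?thesis using row that ex by simp
      qed
      moreover have "bij_betw (\<pi> \<circ> exchange n h v) {..<n} {..<n}"
        using bij_betw_trans[OF exchange_bij[OF ord] p(1)] .
      ultimately show ?thesis
        using True p(2) unfolding R_def shell_step_def by (intro exI[of _ "\<pi> \<circ> exchange n h v"]) auto
    qed
  qed
  moreover have "fold f hs B = fold (step_sem n k) (concat (map (pass_steps n k) (filter (\<lambda>h. h < n) hs))) B" for hs B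
    by (induction hs arbitrary: B) (auto simp: f_def)
  ultimately obtain v where "R (fold (step_sem n k) (sort_steps n k m) A) v" "h_ordered n v 1"
    unfolding sort_steps_def by auto
  then show ?thesis unfolding R_def using h_ordered_1 by (metis comp_apply)
qed

text \<open>Supplies the bit patterns of the positions, which enter the network as biases.\<close>

lemma exists_block_val: "v < 2 ^ 2 ^ s \<Longrightarrow> \<exists>e. (\<forall>l. e l \<in> {0, 1}) \<and> block_val s e 0 = v"
proof (induction s arbitrary: v)
  case 0
  then show ?case by (intro exI[of _ "\<lambda>_. real v"]) auto
next
  case (Suc s)
  define B :: nat where "B = 2 ^ 2 ^ s"
  have "v < B * B" using Suc.prems by (simp add: B_def flip: power_add) (simp add: mult_2)
  then have "v div B < 2 ^ 2 ^ s" "v mod B < 2 ^ 2 ^ s"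
    by (auto simp: B_def less_mult_imp_div_less)
  then obtain e1 e2 where e: "\<forall>l. e1 l \<in> {0, 1::real}" "block_val s e1 0 = v div B"
      "\<forall>l. e2 l \<in> {0, 1::real}" "block_val s e2 0 = v mod B"
    using Suc.IH by meson
  define e where "e l = (if l < 2 ^ s then e1 l else e2 (l - 2 ^ s))" for l
  have "block_val s e 0 = block_val s e1 0" "block_val s e 1 = block_val s e2 0"
    by (rule block_val_cong; simp add: e_def)+
  then have "block_val (Suc s) e 0 = v"
    using e div_mult_mod_eq[of v B] by (simp add: B_def)
  moreover have "\<forall>l. e l \<in> {0, 1}" using e by (simp add: e_def)
  ultimately show ?case by blast
qed

text \<open>Used to see that sorting by position undoes the first sort: the composed permutation is
  monotone.\<close>

lemma mono_bij_id:
  fixes \<rho> :: "nat \<Rightarrow> nat"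
  assumes bij: "bij_betw \<rho> {..<n} {..<n}" and mono: "\<And>i j. \<lbrakk>i \<le> j; j < n\<rbrakk> \<Longrightarrow> \<rho> i \<le> \<rho> j"
  shows "q < n \<Longrightarrow> \<rho> q = q"
proof (induction q rule: less_induct)
  case (less q)
  obtain r where r: "r < n" "\<rho> r = q" using bij less.prems unfolding bij_betw_def by (metis imageE lessThan_iff)
  have "q \<le> r" using less.IH[of r] r by (cases "r < q") auto
  then have "\<rho> q \<le> q" using mono r by blast
  moreover have "\<not> \<rho> q < q"
  proof
    assume lt: "\<rho> q < q"
    then have "\<rho> (\<rho> q) = \<rho> q" using less by simp
    then have "\<rho> q = q" using bij lt less.prems by (auto simp: bij_betw_def inj_on_def)
    with lt show False by simp
  qed
  ultimately show ?case by simp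
qed

section \<open>Associative recall by sorting\<close>

text \<open>A row of the first register has four fields of \<open>2 ^ k0\<close> columns. The initial contents are the
  token, its position in binary, the next token (the payload) and 0; before the second sort they
  are the position, the token, the answer and a flag that marks a match.\<close>

definition field_sel :: "nat \<Rightarrow> nat set \<Rightarrow> real \<Rightarrow> real \<Rightarrow> nat \<Rightarrow> real" where
  "field_sel k0 F x y l = (if l div 2 ^ k0 \<in> F then x else y)"

text \<open>Bit \<open>k0 + 1\<close> pairs fields 0 and 2, which copies the token into the payload
  field. Rotating that field alone by one row replaces the copy by the next token.\<close>

definition init_steps :: "nat \<Rightarrow> (nat \<Rightarrow> nat \<Rightarrow> real) \<Rightarrow> step list" where
  "init_steps k0 idx =
    [lin (k0 + 1) 0 (field_sel k0 {0} 1 0) (field_sel k0 {2} 1 0)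
       (\<lambda>i l. field_sel k0 {1} (idx i (l mod 2 ^ k0)) 0 l),
     rot 0 (\<lambda>l. if l div 2 ^ k0 = 2 then 1 else 0)]"

text \<open>Restricting the difference to field 0 compares tokens only, and \<open>1 - S * S\<close>
  detects equality. Row 0 is masked because its predecessor is the last row. The preceding row is
  recovered by subtracting the stored difference from the row; the final exchange of fields 0 and 1
  makes the position the leading key.\<close>

definition mid_steps :: "nat \<Rightarrow> nat \<Rightarrow> step list" where
  "mid_steps n k0 = (let k = k0 + 2 in
    [lin k 1 (\<lambda>_. 0) (\<lambda>_. 1) (\<lambda>_ _. 0), rot 1 (\<lambda>_. n - 1), lin k 1 (\<lambda>_. - 1) (\<lambda>_. 1) (\<lambda>_ _. 0),
     lin (k + 1) 3 (\<lambda>_. 0) (field_sel k0 {0} 1 0) (\<lambda>_ _. 0)] @ reduce_steps k @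
    [mul 0 3 (- 1) 0 0, scale 3 1 (\<lambda>i. if i = 0 then 0 else 1), lin k 1 (\<lambda>_. - 1) (\<lambda>_. 1) (\<lambda>_ _. 0),
     mul (k + 1) 1 0 1 0, lin (k + 1) 1 (field_sel k0 {3} 0 1) (field_sel k0 {3} 1 0) (\<lambda>_ _. 0),
     lin k 0 (field_sel k0 {2, 3} 0 1) (field_sel k0 {2, 3} 1 0) (\<lambda>_ _. 0),
     lin k0 0 (field_sel k0 {2, 3} 1 0) (field_sel k0 {2, 3} 0 1) (\<lambda>_ _. 0)])"

text \<open>Computes answer \<open>- 2 *\<close> flag \<open>+ 2\<close>: the answer itself after a
  match and 2 otherwise, as the answer field is then 0.\<close>

definition final_steps :: "nat \<Rightarrow> step list" where
  "final_steps k0 =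
    [lin k0 0 (\<lambda>_. 1) (field_sel k0 {2} (- 2) 0) (\<lambda>_. field_sel k0 {2} 2 0),
     lin (k0 + 1) 0 (\<lambda>_. 0) (\<lambda>_. 1) (\<lambda>_ _. 0)]"

lemma field_simps_pow:
  assumes "j < 2 ^ k0"
  shows "(f * 2 ^ k0 + j) div 2 ^ k0 = f" and "(f * 2 ^ k0 + j) mod 2 ^ k0 = j"
    and "flip k0 (f * 2 ^ k0 + j) = flip 0 f * 2 ^ k0 + j"
    and "flip (Suc k0) (f * 2 ^ k0 + j) = flip (Suc 0) f * 2 ^ k0 + j"
  using assms flip_add[of j k0 0 f] flip_add[of j k0 1 f] by simp_all

lemma less_4_cases: "(f::nat) < 4 \<longleftrightarrow> f = 0 \<or> f = 1 \<or> f = 2 \<or> f = 3"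
  by auto

lemma fold_init_steps:
  assumes "j < 2 ^ k0" and "f < 4"
  shows "fold (step_sem n (k0 + 2)) (init_steps k0 idx) A 0 i (f * 2 ^ k0 + j) =
    (if f = 0 then A 0 i j else if f = 1 then idx i j else if f = 2 then A 0 ((i + 1) mod n) j else 0)"
proof -
  have "fold (step_sem n (k0 + 2)) (init_steps k0 idx) A 0 i (f * 2 ^ k0 + j) =
    (let i' = if f = 2 then (i + 1) mod n else i in
     (if f = 0 then 1 else 0) * A 0 i' (f * 2 ^ k0 + j)
     + (if f = 2 then 1 else 0) * A 0 i' (flip (Suc 0) f * 2 ^ k0 + j) + (if f = 1 then idx i' j else 0))"
    by (simp add: init_steps_def field_sel_def field_simps_pow[OF assms(1)] mod_less[OF assms(1)] rotate_rows_def Let_def)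
  then show ?thesis using assms unfolding less_4_cases by (auto simp: Let_def)
qed

lemma fold_final_steps:
  assumes "j < 2 ^ k0"
  shows "fold (step_sem n (k0 + 2)) (final_steps k0) A 0 i j
    = A 0 i (2 * 2 ^ k0 + j) - 2 * A 0 i (3 * 2 ^ k0 + j) + 2"
proof -
  have "fold (step_sem n (k0 + 2)) (final_steps k0) A 0 i (f * 2 ^ k0 + j) =
     (let f' = flip (Suc 0) f in A 0 i (f' * 2 ^ k0 + j)
     + (if f' = 2 then - 2 else 0) * A 0 i (flip 0 f' * 2 ^ k0 + j) + (if f' = 2 then 2 else 0))" for f
    by (simp add: final_steps_def field_sel_def field_simps_pow[OF assms(1)] Let_def)
  from this[of 0] show ?thesis by (simp add: Let_def)
qed

lemma fold_mid_steps_aux: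
  fixes A :: "nat \<Rightarrow> nat \<Rightarrow> nat \<Rightarrow> real" and n k0 :: nat
  defines "X \<equiv> A 0"
  defines "Y \<equiv> \<lambda>i l. rotate_rows n (n - 1) X i l"
  defines "S \<equiv> fold comb_level [0..<k0 + 2] (\<lambda>i l. if l div 2 ^ k0 = 0 then X i l - Y i l else 0)"
  defines "G \<equiv> \<lambda>i l. (1 - S i l * S i l) * (if i = 0 then 0 else 1)"
  assumes "j < 2 ^ k0" and "f < 4"
  shows "fold (step_sem n (k0 + 2)) (mid_steps n k0) A 0 i (f * 2 ^ k0 + j) =
    (if f = 0 then X i (1 * 2 ^ k0 + j) else if f = 1 then X i (0 * 2 ^ k0 + j)
     else if f = 2 then G i (2 * 2 ^ k0 + j) * Y i (2 * 2 ^ k0 + j) else G i (3 * 2 ^ k0 + j))"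
proof -
  let ?k = "k0 + 2"
  let ?s1 = "[lin ?k 1 (\<lambda>_. 0) (\<lambda>_. 1) (\<lambda>_ _. 0), rot 1 (\<lambda>_. n - 1), lin ?k 1 (\<lambda>_. - 1) (\<lambda>_. 1) (\<lambda>_ _. 0),
     lin (?k + 1) 3 (\<lambda>_. 0) (field_sel k0 {0} 1 0) (\<lambda>_ _. 0)]"
  define E where "E = (\<lambda>i l. X i l - Y i l)"
  define E' where "E' = (\<lambda>i l. if l div 2 ^ k0 = 0 then X i l - Y i l else 0)"
  have 1: "fold (step_sem n ?k) ?s1 A = A(1 := E, 3 := E')"
    by (auto simp: E_def E'_def X_def Y_def fun_eq_iff rotate_rows_def field_sel_def)
  obtain J where J: "fold (step_sem n ?k) (reduce_steps ?k) (A(1 := E, 3 := E'))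
      = (A(1 := E, 3 := E'))(2 := J, 3 := S)"
    using fold_reduce_steps[of n ?k "A(1 := E, 3 := E')"] by (auto simp: S_def E'_def)
  define H1 where "H1 = (\<lambda>i l. if l div 2 ^ k0 = 3 then G i l else G i l * Y i l)"
  define H where "H = (\<lambda>i l. if l div 2 ^ k0 \<in> {2, 3} then H1 i l else X i l)"
  \<comment> \<open>A normal form for states, so that the following equations chain by plain
    rewriting.\<close>
  let ?B = "\<lambda>x y z. A(1 := x, 2 := J, 3 := y, 0 := z)"
  have 2: "(A(1 := E, 3 := E'))(2 := J, 3 := S) = ?B E S X"
    by (auto simp: X_def fun_eq_iff)
  have 3: "step_sem n ?k (mul 0 3 (- 1) 0 0) (?B E S X) = ?B E (\<lambda>i l. - (S i l * S i l)) X"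
    by (auto simp: fun_eq_iff)
  have 4: "step_sem n ?k (scale 3 1 (\<lambda>i. if i = 0 then 0 else 1)) (?B E (\<lambda>i l. - (S i l * S i l)) X) = ?B E G X"
    by (auto simp: fun_eq_iff G_def)
  have 5: "step_sem n ?k (lin ?k 1 (\<lambda>_. - 1) (\<lambda>_. 1) (\<lambda>_ _. 0)) (?B E G X) = ?B Y G X"
    by (auto simp: fun_eq_iff E_def)
  have 6: "step_sem n ?k (mul (?k + 1) 1 0 1 0) (?B Y G X) = ?B (\<lambda>i l. G i l * Y i l) G X"
    by (auto simp: fun_eq_iff)
  have 7: "step_sem n ?k (lin (?k + 1) 1 (field_sel k0 {3} 0 1) (field_sel k0 {3} 1 0) (\<lambda>_ _. 0))
      (?B (\<lambda>i l. G i l * Y i l) G X) = ?B H1 G X"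
    by (auto simp: fun_eq_iff H1_def field_sel_def)
  have 8: "step_sem n ?k (lin ?k 0 (field_sel k0 {2, 3} 0 1) (field_sel k0 {2, 3} 1 0) (\<lambda>_ _. 0))
      (?B H1 G X) = ?B H1 G H"
    by (auto simp: fun_eq_iff H_def field_sel_def)
  have "fold (step_sem n ?k) (mid_steps n k0) A =
      step_sem n ?k (lin k0 0 (field_sel k0 {2, 3} 1 0) (field_sel k0 {2, 3} 0 1) (\<lambda>_ _. 0)) (?B H1 G H)"
    unfolding mid_steps_def Let_def fold_append comp_apply 1 J 2
    by (simp only: fold.simps comp_apply id_apply 3 4 5 6 7 8)
  then have "fold (step_sem n ?k) (mid_steps n k0) A 0 i (f * 2 ^ k0 + j) =
      (if f \<in> {2, 3} then H i (f * 2 ^ k0 + j) else H i (flip 0 f * 2 ^ k0 + j))"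
    by (simp add: field_sel_def field_simps_pow[OF assms(5)])
  moreover have H: "H i (f * 2 ^ k0 + j) = (if f = 2 then G i (f * 2 ^ k0 + j) * Y i (f * 2 ^ k0 + j)
      else if f = 3 then G i (f * 2 ^ k0 + j) else X i (f * 2 ^ k0 + j))" for f
    by (simp add: H_def H1_def field_simps_pow[OF assms(5)])
  moreover have "flip 0 f = (if f = 0 then 1 else 0)" if "f < 2"
    using that by (auto simp: flip_def less_2_cases_iff)
  ultimately show ?thesis using assms(6) unfolding H less_4_cases by auto
qed

lemma fold_mid_steps:
  fixes A :: "nat \<Rightarrow> nat \<Rightarrow> nat \<Rightarrow> real" and n k0 i :: nat
  defines "hit \<equiv> i \<noteq> 0 \<and> (\<forall>j<2 ^ k0. A 0 i j = A 0 (i - 1) j)"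
  assumes bits: "\<And>i l. \<lbrakk>i < n; l < 2 ^ (k0 + 2)\<rbrakk> \<Longrightarrow> A 0 i l \<in> {0, 1}"
    and i: "i < n" and j: "j < 2 ^ k0" and f: "f < 4"
  shows "fold (step_sem n (k0 + 2)) (mid_steps n k0) A 0 i (f * 2 ^ k0 + j) =
    (if f = 0 then A 0 i (2 ^ k0 + j) else if f = 1 then A 0 i j
     else if f = 2 then (if hit then A 0 (i - 1) (2 * 2 ^ k0 + j) else 0) else (if hit then 1 else 0))"
proof -
  define Y where "Y = (\<lambda>i l. rotate_rows n (n - 1) (A 0) i l)"
  define S where "S = fold comb_level [0..<k0 + 2] (\<lambda>i l. if l div 2 ^ k0 = 0 then A 0 i l - Y i l else 0)"
  define G where "G = (\<lambda>i l. (1 - S i l * S i l) * (if i = 0 then 0 else 1))"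
  have G: "G i (f * 2 ^ k0 + j) = (if hit then 1 else 0)"
    and Y: "hit \<Longrightarrow> Y i l = A 0 (i - 1) l" if "f < 4" for f l
  proof -
    show "G i (f * 2 ^ k0 + j) = (if hit then 1 else 0)"
    proof (cases "i = 0")
      case False
      then have "(i + (n - 1)) mod n = i - 1" using i by (auto simp: mod_if)
      then have Y: "Y i l = A 0 (i - 1) l" for l
        using i False by (auto simp: Y_def rotate_rows_def)
      define e where "e i l = (if l div 2 ^ k0 = 0 then A 0 i l else 0)" for i l
      have e: "e i l \<in> {0, 1}" if "l div 2 ^ (k0 + 2) = 0" "i < n" for i l
        using bits that unfolding div_power_eq_0 by (simp add: e_def)
      have "f * 2 ^ k0 + j < (f + 1) * 2 ^ k0" using j by simp
      also have "\<dots> \<le> 4 * 2 ^ k0" using that by (intro mult_le_mono1) simp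
      finally have "(f * 2 ^ k0 + j) div 2 ^ (k0 + 2) = 0"
        unfolding div_power_eq_0 by simp
      moreover have "(\<lambda>l. if l div 2 ^ k0 = 0 then A 0 i l - Y i l else 0) = (\<lambda>l. e i l - e (i - 1) l)"
        by (auto simp: Y e_def)
      ultimately have "S i (f * 2 ^ k0 + j) = block_comb (k0 + 2) (\<lambda>l. e i l - e (i - 1) l) 0"
        unfolding S_def fold_comb_level by (simp only:)
      also have "\<dots> = cmp (block_val (k0 + 2) (e i) 0) (block_val (k0 + 2) (e (i - 1)) 0)"
        by (rule block_comb_diff) (use e i in auto)
      finally have S: "S i (f * 2 ^ k0 + j) = \<dots>" .
      have "block_val (k0 + 2) (e i) 0 = block_val (k0 + 2) (e (i - 1)) 0 \<longleftrightarrow>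
          (\<forall>l. l div 2 ^ (k0 + 2) = 0 \<longrightarrow> e i l = e (i - 1) l)"
        by (rule block_val_eq_iff) (use e i in auto)
      also have "\<dots> \<longleftrightarrow> hit"
        using False unfolding div_power_eq_0 hit_def by (auto simp: e_def div_power_eq_0)
      finally show ?thesis
        using False by (auto simp: G_def S cmp_def)
    qed (simp add: G_def hit_def)
    show "Y i l = A 0 (i - 1) l" if hit
    proof -
      have "i \<noteq> 0" using that by (simp add: hit_def)
      then have "(i + (n - 1)) mod n = i - 1" using i by (auto simp: mod_if)
      then show ?thesis using i \<open>i \<noteq> 0\<close> by (auto simp: Y_def rotate_rows_def)
    qed
  qed
  have G': "(1 - S i (2 * 2 ^ k0 + j) * S i (2 * 2 ^ k0 + j)) * (if i = 0 then 0 else 1) = (if hit then 1 else 0)"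
    "(1 - S i (3 * 2 ^ k0 + j) * S i (3 * 2 ^ k0 + j)) * (if i = 0 then 0 else 1) = (if hit then 1 else 0)"
    using G[of 2] G[of 3] by (simp_all only: G_def)
  show ?thesis
    using Y[OF f] unfolding fold_mid_steps_aux[OF j f, of n A i, folded Y_def, folded S_def] G' by simp
qed

text \<open>Fields 0 and 1 are the leading quarters of the number, so a difference there decides
  whatever the remaining fields hold.\<close>

lemma block_val_fields_less:
  "block_val (k0 + 2) e 0 < block_val (k0 + 2) e' 0"
  if "block_val k0 e 0 < block_val k0 e' 0 \<or>
    block_val k0 e 0 = block_val k0 e' 0 \<and> block_val k0 e 1 < block_val k0 e' 1"
  using that block_val_Suc_less[of "Suc k0" e 0 e' 0] block_val_Suc_less[of k0 e 0 e' 0] by simp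

lemma field_bits:
  assumes "\<And>f j. \<lbrakk>f < 4; j < 2 ^ k0\<rbrakk> \<Longrightarrow> P (f * 2 ^ k0 + j)" and "l < 2 ^ (k0 + 2)"
  shows "P (l::nat)"
proof -
  have "l div 2 ^ k0 < 4" using assms(2) by (simp add: less_mult_imp_div_less mult.commute)
  then show ?thesis using assms(1)[of "l div 2 ^ k0" "l mod 2 ^ k0"] by (simp add: div_mult_mod_eq)
qed

definition mqar_steps :: "nat \<Rightarrow> nat \<Rightarrow> nat \<Rightarrow> (nat \<Rightarrow> nat \<Rightarrow> real) \<Rightarrow> step list" where
  "mqar_steps n k0 m idx = init_steps k0 idx @ sort_steps n (k0 + 2) m @ mid_steps n k0 @
     sort_steps n (k0 + 2) m @ final_steps k0"

lemma fold_mqar_steps: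
  fixes A :: "nat \<Rightarrow> nat \<Rightarrow> nat \<Rightarrow> real" and T :: "nat \<Rightarrow> nat \<Rightarrow> real" and n k0 m q :: nat
    and idx :: "nat \<Rightarrow> nat \<Rightarrow> real"
  defines "same i' i \<equiv> \<forall>j<2 ^ k0. T i' j = T i j"
  assumes n: "n \<le> 2 ^ m" and A: "\<And>i j. \<lbrakk>i < n; j < 2 ^ k0\<rbrakk> \<Longrightarrow> A 0 i j = T i j"
    and T: "\<And>i j. \<lbrakk>i < n; j < 2 ^ k0\<rbrakk> \<Longrightarrow> T i j \<in> {0, 1}"
    and idx: "\<And>i j. idx i j \<in> {0, 1}" "\<And>i. i < n \<Longrightarrow> block_val k0 (idx i) 0 = i"
    and q: "q < n"
  defines "out \<equiv> fold (step_sem n (k0 + 2)) (mqar_steps n k0 m idx) A 0 q"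
  shows "(\<exists>i<q. same i q \<and> (\<forall>j<2 ^ k0. out j = T (i + 1) j)) \<or>
    (\<not> (\<exists>i<q. same i q) \<and> (\<forall>j<2 ^ k0. out j = 2))"
proof -
  let ?k = "k0 + 2" and ?sem = "step_sem n (k0 + 2)"
  define A1 where "A1 = fold ?sem (init_steps k0 idx) A"
  define A2 where "A2 = fold ?sem (sort_steps n ?k m) A1"
  define A3 where "A3 = fold ?sem (mid_steps n k0) A2"
  define A4 where "A4 = fold ?sem (sort_steps n ?k m) A3"
  have out: "out j = A4 0 q (2 * 2 ^ k0 + j) - 2 * A4 0 q (3 * 2 ^ k0 + j) + 2" if "j < 2 ^ k0" for j
    using fold_final_steps[OF that] by (simp add: out_def mqar_steps_def A1_def A2_def A3_def A4_def)
  have lt: "f * 2 ^ k0 + j < 2 ^ ?k" if "j < 2 ^ k0" "f < 4" for f j :: nat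
  proof -
    have "f * 2 ^ k0 + j < (f + 1) * 2 ^ k0" using that by simp
    also have "\<dots> \<le> 4 * 2 ^ k0" using that by (intro mult_le_mono1) simp
    finally show ?thesis by simp
  qed

  have A1: "A1 0 i (f * 2 ^ k0 + j) =
      (if f = 0 then T i j else if f = 1 then idx i j else if f = 2 then T ((i + 1) mod n) j else 0)"
    if "i < n" "f < 4" "j < 2 ^ k0" for i f j
    unfolding A1_def fold_init_steps[OF that(3,2)] using that A q by auto
  have bits1: "A1 0 i l \<in> {0, 1}" if "i < n" "l < 2 ^ ?k" for i l
    using that(2)
  proof (rule field_bits[rotated])
    show "A1 0 i (f * 2 ^ k0 + j) \<in> {0, 1}" if "f < 4" "j < 2 ^ k0" for f j
    proof -
      have "(i + 1) mod n < n" using q by simp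
      then show ?thesis unfolding A1[OF \<open>i < n\<close> that] using T that idx(1) \<open>i < n\<close> by auto
    qed
  qed
  define tok where "tok i = block_val k0 (T i) 0" for i
  define K1 where "K1 i = block_val ?k (A1 0 i) 0" for i
  have tok_eq: "tok i = tok i' \<longleftrightarrow> same i i'" if "i < n" "i' < n" for i i'
    unfolding tok_def same_def
    by (subst block_val_eq_iff) (use T that in \<open>auto simp only: div_power_eq_0\<close>)
  have "block_val k0 (A1 0 i) 0 = tok i" "block_val k0 (A1 0 i) 1 = i" if "i < n" for i
  proof -
    show "block_val k0 (A1 0 i) 0 = tok i"
      unfolding tok_def by (rule block_val_cong) (use A1[OF that, of 0] in auto)
    have "block_val k0 (A1 0 i) 1 = block_val k0 (idx i) 0"
      by (rule block_val_cong) (use A1[OF that, of 1] in auto)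
    then show "block_val k0 (A1 0 i) 1 = i" using idx(2) that by simp
  qed
  \<comment> \<open>The position in field 1 breaks ties, so records with equal tokens come out in
    their original order.\<close>
  then have K1: "K1 i < K1 i'" if "tok i < tok i' \<or> tok i = tok i' \<and> i < i'" "i < n" "i' < n" for i i'
    using that unfolding K1_def by (intro block_val_fields_less) auto
  have "\<exists>p. bij_betw p {..<n} {..<n} \<and> (\<forall>i<n. \<forall>l<2 ^ ?k. A2 0 i l = A1 0 (p i) l)
      \<and> (\<forall>i j. i \<le> j \<longrightarrow> j < n \<longrightarrow> K1 (p i) \<le> K1 (p j))"
    unfolding A2_def K1_def by (rule fold_sort_steps[where A = A1, OF n]) (rule bits1)
  then obtain p where p: "bij_betw p {..<n} {..<n}"
    and rows: "\<forall>i<n. \<forall>l<2 ^ ?k. A2 0 i l = A1 0 (p i) l"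
    and mono: "\<forall>i j. i \<le> j \<longrightarrow> j < n \<longrightarrow> K1 (p i) \<le> K1 (p j)"
    by (elim exE conjE)
  note row2 = rows[rule_format] and sorted = mono[rule_format]
  have p_less: "p i < n" if "i < n" for i using p that by (auto simp: bij_betw_def)

  have bits2: "A2 0 i l \<in> {0, 1}" if "i < n" "l < 2 ^ ?k" for i l
    using row2 bits1 p_less that by simp
  define hit where "hit i \<longleftrightarrow> i \<noteq> 0 \<and> same (p (i - 1)) (p i)" for i
  have row2': "A2 0 i (f * 2 ^ k0 + j) = A1 0 (p i) (f * 2 ^ k0 + j)" if "i < n" "f < 4" "j < 2 ^ k0" for i f j
    using row2 lt that by simp
  have tok2: "A2 0 i j = T (p i) j" if "i < n" "j < 2 ^ k0" for i j
    using row2'[OF that(1) _ that(2), of 0] A1[OF p_less[OF that(1)] _ that(2), of 0] by simp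
  have hit: "i \<noteq> 0 \<and> (\<forall>j<2 ^ k0. A2 0 i j = A2 0 (i - 1) j) \<longleftrightarrow> hit i" if "i < n" for i
    using tok2 that by (auto simp: hit_def same_def)
  have A3: "A3 0 i (f * 2 ^ k0 + j) = (if f = 0 then idx (p i) j else if f = 1 then T (p i) j
      else if f = 2 then (if hit i then T ((p (i - 1) + 1) mod n) j else 0) else (if hit i then 1 else 0))"
    if "i < n" "f < 4" "j < 2 ^ k0" for i f j
  proof -
    have 1: "A2 0 i (2 ^ k0 + j) = idx (p i) j"
      using row2'[of i 1 j] A1[of "p i" 1 j] that p_less by simp
    have 2: "A2 0 (i - 1) (2 * 2 ^ k0 + j) = T ((p (i - 1) + 1) mod n) j"
      using row2'[of "i - 1" 2 j] A1[of "p (i - 1)" 2 j] that p_less[of "i - 1"] by simp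
    show ?thesis
      using fold_mid_steps[where A = A2, OF bits2 that(1,3,2)] tok2[OF that(1,3)]
      unfolding A3_def[symmetric] hit[OF that(1)] 1 2 by simp
  qed
  have bits3: "A3 0 i l \<in> {0, 1}" if "i < n" "l < 2 ^ ?k" for i l
    using that(2)
  proof (rule field_bits[rotated])
    show "A3 0 i (f * 2 ^ k0 + j) \<in> {0, 1}" if "f < 4" "j < 2 ^ k0" for f j
    proof -
      have "(p (i - 1) + 1) mod n < n" using q by simp
      then show ?thesis unfolding A3[OF \<open>i < n\<close> that] using T that idx(1) \<open>i < n\<close> p_less by auto
    qed
  qed
  define K3 where "K3 i = block_val ?k (A3 0 i) 0" for i
  have "block_val k0 (A3 0 i) 0 = p i" if "i < n" for i
  proof -
    have "block_val k0 (A3 0 i) 0 = block_val k0 (idx (p i)) 0"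
      by (rule block_val_cong) (use A3[OF that, of 0] in auto)
    then show ?thesis using idx(2) p_less that by simp
  qed
  then have K3: "K3 i < K3 i'" if "p i < p i'" "i < n" "i' < n" for i i'
    using that unfolding K3_def by (intro block_val_fields_less) auto
  have "\<exists>p. bij_betw p {..<n} {..<n} \<and> (\<forall>i<n. \<forall>l<2 ^ ?k. A4 0 i l = A3 0 (p i) l)
      \<and> (\<forall>i j. i \<le> j \<longrightarrow> j < n \<longrightarrow> K3 (p i) \<le> K3 (p j))"
    unfolding A4_def K3_def by (rule fold_sort_steps[where A = A3, OF n]) (rule bits3)
  then obtain r where r: "bij_betw r {..<n} {..<n}"
    and rows: "\<forall>i<n. \<forall>l<2 ^ ?k. A4 0 i l = A3 0 (r i) l"
    and mono: "\<forall>i j. i \<le> j \<longrightarrow> j < n \<longrightarrow> K3 (r i) \<le> K3 (r j)"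
    by (elim exE conjE)
  note row4 = rows[rule_format] and sorted' = mono[rule_format]
  have r_less: "r i < n" if "i < n" for i using r that by (auto simp: bij_betw_def)
  \<comment> \<open>\<open>p (r i)\<close> is the original position of the record in row
    \<open>i\<close> after both sorts. The second sort makes it monotone in \<open>i\<close>, hence
    equal to \<open>i\<close>.\<close>
  have pr: "p (r q) = q"
  proof -
    have "(p \<circ> r) q = q"
    proof (rule mono_bij_id[OF bij_betw_trans[OF r p] _ q])
      show "(p \<circ> r) i \<le> (p \<circ> r) j" if "i \<le> j" "j < n" for i j
        using sorted'[OF that] K3[of "r j" "r i"] r_less that by (auto simp: not_less[symmetric])
    qed
    then show ?thesis by simp
  qed
  define s where "s = r q"
  have s: "s < n" "p s = q" using r_less q pr by (auto simp: s_def)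
  have outj: "out j = (if hit s then T ((p (s - 1) + 1) mod n) j else 2)" if "j < 2 ^ k0" for j
    using out[OF that] row4[OF q lt[OF that, of 2]] row4[OF q lt[OF that, of 3]]
      A3[OF s(1) _ that, of 2] A3[OF s(1) _ that, of 3] by (simp add: s_def)
  show ?thesis
  proof (cases "hit s")
    case True
    let ?i = "p (s - 1)"
    have i: "?i < n" using p_less s by simp
    have "s \<noteq> 0" "same ?i q" using True s by (auto simp: hit_def)
    have "?i \<noteq> q"
    proof
      assume "?i = q"
      then have "s - 1 = s"
        using p s inj_onD[of p "{..<n}" "s - 1" s] by (auto simp: bij_betw_def)
      then show False using \<open>s \<noteq> 0\<close> by simp
    qed
    \<comment> \<open>With equal tokens, a later position in row \<open>s - 1\<close> would
      contradict the first sort.\<close>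
    moreover have "\<not> q < ?i"
      using sorted[of "s - 1" s] K1[of q ?i] tok_eq[of ?i q] \<open>same ?i q\<close> s i by auto
    ultimately have "?i < q" by simp
    \<comment> \<open>As \<open>?i < q < n\<close>, the successor is a genuine row and the
      wraparound of the payload rotation is harmless.\<close>
    moreover have "out j = T (?i + 1) j" if "j < 2 ^ k0" for j
      using outj[OF that] True \<open>?i < q\<close> q by simp
    ultimately show ?thesis using \<open>same ?i q\<close> by blast
  next
    case False
    \<comment> \<open>An earlier occurrence \<open>i\<close> would lie in some row
      \<open>t < s\<close>. Row \<open>s - 1\<close> then lies between \<open>i\<close> and
      \<open>q\<close> in key order, so its token is squeezed between equal tokens and row
      \<open>s\<close> would be a hit.\<close>
    have "\<not> same i q" if "i < q" for i
    proof
      assume *: "same i q"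
      have "i < n" using that q by simp
      then obtain t where t: "t < n" "p t = i"
        using p unfolding bij_betw_def by (metis imageE lessThan_iff)
      have ti: "tok i = tok q" using * tok_eq \<open>i < n\<close> q by simp
      have "t < s"
        using K1[of i q] ti that \<open>i < n\<close> q sorted[of s t] t s by (cases "t < s") auto
      then have le: "K1 i \<le> K1 (p (s - 1))" "K1 (p (s - 1)) \<le> K1 q" "p (s - 1) < n"
        using sorted[of t "s - 1"] sorted[of "s - 1" s] t s p_less by auto
      have "tok i \<le> tok (p (s - 1))" "tok (p (s - 1)) \<le> tok q"
        using le K1[of "p (s - 1)" i] K1[of q "p (s - 1)"] \<open>i < n\<close> q by (auto simp: not_less[symmetric])
      then have "same (p (s - 1)) q" using ti tok_eq le(3) q by simp
      then show False using False \<open>t < s\<close> s by (simp add: hit_def)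
    qed
    then show ?thesis using outj False by simp
  qed
qed

section \<open>Size bounds\<close>

lemma length_reduce_steps: "length (reduce_steps k) = 6 * k"
  by (simp add: reduce_steps_def length_concat comb_steps_def o_def sum_list_triv)

lemma length_sort_steps: "length (sort_steps n k m) \<le> m * m * (6 * k + 10)"
proof -
  have "length (sort_steps n k m) = length (filter (\<lambda>h. h < n) (pratt m)) * (6 * k + 10)"
    by (simp add: sort_steps_def length_concat pass_steps_def length_reduce_steps o_def sum_list_triv algebra_simps)
  also have "\<dots> \<le> m * m * (6 * k + 10)"
    by (intro mult_le_mono1) (metis length_filter_le length_pratt)
  finally show ?thesis .
qed

lemma length_mqar_steps:
  assumes "1 \<le> m"
  shows "length (mqar_steps n k0 m idx) \<le> 4 * (m * m) * (6 * (k0 + 4))"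
proof -
  have "length (mqar_steps n k0 m idx) \<le> 2 * (m * m * (6 * (k0 + 2) + 10)) + (6 * (k0 + 2) + 15)"
    using length_sort_steps[of n "k0 + 2" m]
    by (simp add: mqar_steps_def init_steps_def mid_steps_def final_steps_def Let_def length_reduce_steps)
  also have "\<dots> \<le> 2 * (m * m * (6 * (k0 + 4))) + 2 * (1 * (6 * (k0 + 4)))" by (simp add: algebra_simps)
  also have "\<dots> \<le> 2 * (m * m * (6 * (k0 + 4))) + 2 * (m * m * (6 * (k0 + 4)))"
    using assms by (intro add_left_mono mult_le_mono le_refl) (simp add: Suc_le_eq)
  finally show ?thesis by simp
qed

lemma exch_bit_mqar_steps: "\<forall>S\<in>set (mqar_steps n k0 m idx). exch_bit S < k0 + 2 + 2"
  by (auto simp: mqar_steps_def init_steps_def mid_steps_def final_steps_def Let_def sort_steps_def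
      pass_steps_def reduce_steps_def comb_steps_def)

text \<open>A field has \<open>2 ^ k0\<close> columns, enough for a token of \<open>d\<close> bits
  and for a position of \<open>P\<close> bits, yet at most \<open>2 * (d + P)\<close>. Taking
  \<open>max K 1\<close> keeps the constants positive for every \<open>K\<close>.\<close>

lemma size_bounds:
  fixes K :: real and N c d :: nat
  defines "Z \<equiv> N * log 2 (real c)" and "P \<equiv> Suc (floor_log N)" and "\<kappa> \<equiv> max K 1"
  defines "\<theta> \<equiv> 1 + log 2 Z" and "k0 \<equiv> Suc (floor_log (d + P))" and "\<mu> \<equiv> 6 + log 2 \<kappa>"
  assumes N: "1 \<le> N" and c: "2 \<le> c" and d: "real d \<le> K * log 2 (real c)"
  shows "1 \<le> Z" and "1 \<le> \<theta>" and "real P \<le> \<theta>" and "real (N * 2 ^ (k0 + 4)) \<le> 64 * \<kappa> * Z * \<theta>"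
    and "real (k0 + 4) \<le> \<mu> * \<theta>"
proof -
  have lc: "1 \<le> log 2 (real c)" using c by simp
  have NZ: "real N \<le> Z" using mult_left_mono[OF lc, of "real N"] by (simp add: Z_def)
  then show Z: "1 \<le> Z" using N by linarith
  then show l: "1 \<le> \<theta>" by (simp add: \<theta>_def)
  have k: "1 \<le> \<kappa>" "K \<le> \<kappa>" by (simp_all add: \<kappa>_def)
  have fl: "real (floor_log n) \<le> log 2 (real n)" if "0 < n" for n
    using floor_log_exp2_le[OF that] that by (simp add: le_log_iff powr_realpow flip: of_nat_power)
  have "log 2 (real N) \<le> log 2 Z" using N NZ by simp
  then show P: "real P \<le> \<theta>" using fl[of N] N by (simp add: P_def \<theta>_def)
  have "floor_log N < 2 ^ floor_log N" by (rule less_exp)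
  then have "P \<le> N" using floor_log_exp2_le[of N] N unfolding P_def by linarith
  have dZ: "real N * real d \<le> \<kappa> * Z"
  proof -
    have "real d \<le> \<kappa> * log 2 (real c)" using d mult_right_mono[OF k(2), of "log 2 (real c)"] lc by linarith
    then have "real N * real d \<le> real N * (\<kappa> * log 2 (real c))" by (intro mult_left_mono) auto
    then show ?thesis by (simp add: Z_def algebra_simps)
  qed
  have kZ: "Z \<le> \<kappa> * Z" "\<kappa> * Z \<le> \<kappa> * Z * \<theta>"
    using mult_right_mono[OF k(1), of Z] mult_left_mono[OF l, of "\<kappa> * Z"] Z k by auto
  have pos: "0 < d + P" by (simp add: P_def)
  have two: "2 ^ k0 \<le> 2 * (d + P)" using floor_log_exp2_le[OF pos] by (simp add: k0_def)
  have "real (N * 2 ^ k0) \<le> real (N * (2 * (d + P)))"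
    using two by (simp only: of_nat_le_iff) (rule mult_le_mono2)
  also have "\<dots> = 2 * (real N * real d) + 2 * (real N * real P)" by (simp add: algebra_simps)
  also have "\<dots> \<le> 2 * (\<kappa> * Z * \<theta>) + 2 * (\<kappa> * Z * \<theta>)"
  proof -
    have "real N * real P \<le> Z * \<theta>" using NZ P Z by (intro mult_mono) auto
    also have "\<dots> \<le> \<kappa> * Z * \<theta>" using kZ l by (intro mult_right_mono) auto
    finally show ?thesis using dZ kZ by linarith
  qed
  finally show "real (N * 2 ^ (k0 + 4)) \<le> 64 * \<kappa> * Z * \<theta>" by (simp add: power_add)
  have "real d \<le> real N * real d" using N by (cases "d = 0") auto
  then have "real (d + P) \<le> 2 * \<kappa> * Z"
    using dZ NZ kZ \<open>P \<le> N\<close> by (simp add: algebra_simps)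
  then have "log 2 (real (d + P)) \<le> log 2 (2 * \<kappa> * Z)" using pos by (intro log_mono) auto
  also have "\<dots> = 1 + log 2 \<kappa> + log 2 Z" using k Z by (simp add: log_mult)
  finally have "real k0 \<le> 2 + log 2 \<kappa> + log 2 Z" using fl[OF pos] by (simp add: k0_def)
  \<comment> \<open>The 6 in \<open>\<mu>\<close> is the 4 added here plus the 2 in the bound on
    \<open>k0\<close>.\<close>
  then have "real (k0 + 4) \<le> \<mu> + (\<theta> - 1)" by (simp add: \<mu>_def \<theta>_def)
  also have "\<dots> \<le> \<mu> * \<theta>"
  proof -
    have "0 \<le> (\<mu> - 1) * (\<theta> - 1)" using l k by (simp add: \<mu>_def)
    then show ?thesis by (simp add: algebra_simps)
  qed
  finally show "real (k0 + 4) \<le> \<mu> * \<theta>" .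
qed

text \<open>The zero-padded input is the packed state whose register 0 starts with the tokens and is
  0 elsewhere; since \<open>d \<le> 2 ^ k0\<close>, padding does not affect equality of
  tokens.\<close>

lemma baseconv_apply_mqar:
  fixes x :: "nat \<Rightarrow> nat" and d N k0 m :: nat and idx :: "nat \<Rightarrow> nat \<Rightarrow> real"
  assumes N: "1 \<le> N" "N \<le> 2 ^ m" and d: "1 \<le> d" "d \<le> 2 ^ k0" and emb: "embedding C d emb"
    and x: "\<forall>i<N. x i \<in> C"
    and idx: "\<And>i j. idx i j \<in> {0, 1}" "\<And>i. i < N \<Longrightarrow> block_val k0 (idx i) 0 = i"
    and T: "inner_rows T = N" "inner_cols T = 2 ^ (k0 + 4)"
      "layers T = map (compile N (k0 + 2)) (mqar_steps N k0 m idx)"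
  shows "solves_mqar (emb ` C) (embed_tokens N d emb x) (baseconv_apply T (embed_tokens N d emb x))"
proof -
  let ?u = "embed_tokens N d emb x" and ?k = "k0 + 2"
  define tok where "tok i l = (if l < d then emb (x i) $ l else 0)" for i l
  define A where "A r i l = (if r = 0 then tok i l else 0)" for r i l :: nat
  let ?B = "fold (step_sem N ?k) (mqar_steps N k0 m idx) A"
  have k4: "(2::nat) ^ (k0 + 4) = 2 ^ (?k + 2)" by (simp add: power_add)
  have dk: "d \<le> 2 ^ ?k" using d(2) by (rule le_trans) (simp add: power_add)
  have dk4: "d \<le> 2 ^ (k0 + 4)" using d(2) by (rule le_trans) (simp add: power_add)
  have dims: "dim_row ?u = N" "dim_col ?u = d" by (simp_all add: embed_tokens_def)
  have "resize N (2 ^ (k0 + 4)) ?u = pack N ?k A"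
  proof (rule eq_matI)
    fix i c assume "i < dim_row (pack N ?k A)" "c < dim_col (pack N ?k A)"
    then have ic: "i < N" "c < 2 ^ (k0 + 4)" by (simp_all add: pack_def k4)
    have "A (c div 2 ^ ?k) i (c mod 2 ^ ?k) = tok i c"
    proof (cases "c < 2 ^ ?k")
      case False
      then have "c div 2 ^ ?k \<noteq> 0" unfolding div_power_eq_0 .
      then show ?thesis using False dk by (simp add: A_def tok_def)
    qed (simp add: A_def)
    then show "resize N (2 ^ (k0 + 4)) ?u $$ (i, c) = pack N ?k A $$ (i, c)"
      using ic unfolding pack_def resize_def k4[symmetric] by (simp add: dims tok_def embed_tokens_def)
  qed (simp_all add: resize_def pack_def power_add)
  then have "fold layer_apply (layers T) (resize (inner_rows T) (inner_cols T) ?u) = pack N ?k ?B"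
    using fold_layer_apply_compile[OF _ exch_bit_mqar_steps, of N k0 N m idx A] N unfolding T by simp
  then have out: "baseconv_apply T ?u = mat N d (\<lambda>(i, j). ?B 0 i j)"
    unfolding baseconv_apply_def dims resize_def using dk dk4
    by (intro cong_mat) (auto simp: pack_def k4[symmetric])
  have bits: "tok i j \<in> {0, 1}" if "i < N" for i j
    using emb x that by (auto simp: embedding_def tok_def)
  have main: "(\<exists>i'<i. (\<forall>j<2 ^ k0. tok i' j = tok i j) \<and> (\<forall>j<2 ^ k0. ?B 0 i j = tok (i' + 1) j)) \<or>
    (\<not> (\<exists>i'<i. \<forall>j<2 ^ k0. tok i' j = tok i j) \<and> (\<forall>j<2 ^ k0. ?B 0 i j = 2))" if "i < N" for i
    by (rule fold_mqar_steps[where A = A and T = tok, OF N(2) _ _ idx that]) (use bits in \<open>simp_all add: A_def\<close>)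
  have rows: "row ?u i' = row ?u i \<longleftrightarrow> (\<forall>j<2 ^ k0. tok i' j = tok i j)" if "i < N" "i' < N" for i i'
    using that d(2) by (auto simp: vec_eq_iff embed_tokens_def tok_def)
  show ?thesis
    unfolding solves_mqar_def dims
  proof (intro allI impI)
    fix i assume "1 \<le> i \<and> i < N"
    then have i: "i < N" by simp
    let ?v = "baseconv_apply T ?u"
    have rowv: "row ?v i = vec d (\<lambda>j. ?B 0 i j)" using i by (auto simp: out)
    have ex: "(\<exists>i'<i. row ?u i = row ?u i') \<longleftrightarrow> (\<exists>i'<i. \<forall>j<2 ^ k0. tok i' j = tok i j)"
      using rows[OF i] i by (metis less_trans)
    show "if \<exists>j<i. row ?u i = row ?u j then \<exists>j<i. row ?u i = row ?u j \<and> row ?v i = row ?u (j + 1)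
        else row ?v i \<notin> emb ` C"
    proof (cases "\<exists>j<i. row ?u i = row ?u j")
      case True
      then obtain i' where i': "i' < i" "\<forall>j<2 ^ k0. tok i' j = tok i j" "\<forall>j<2 ^ k0. ?B 0 i j = tok (i' + 1) j"
        using main[OF i] unfolding ex by blast
      have "row ?v i = row ?u (i' + 1)"
        unfolding rowv using i' i d(2) by (auto simp: embed_tokens_def tok_def)
      then show ?thesis using True rows[OF i, of i'] i' i by auto
    next
      case False
      then have "?B 0 i 0 = 2" using main[OF i] unfolding ex by auto
      then have "row ?v i $ 0 = 2" unfolding rowv using d by simp
      moreover have "emb y $ 0 \<in> {0, 1}" if "y \<in> C" for y using emb that d by (auto simp: embedding_def)
      ultimately have "row ?v i \<notin> emb ` C" by fastforce
      then show ?thesis unfolding if_not_P[OF False] .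
    qed
  qed
qed

theorem theorem4p4:
  fixes K :: real
  shows "\<exists>(A::real) (a::nat). \<forall>(N::nat) (C::nat set) (c::nat) (d::nat) (emb::nat \<Rightarrow> real vec).
    1 \<le> N \<longrightarrow> finite C \<longrightarrow> card C = c \<longrightarrow> 2 \<le> c \<longrightarrow>
    real d \<le> K * log 2 (real c) \<longrightarrow> embedding C d emb \<longrightarrow>
    (\<exists>T t. baseconv_wf N d T \<and>
       (\<forall>L\<in>set (layers T).
          real (width L) \<le> polylog A a (real (inner_cols T)) \<and>
          real (expansion L) \<le> polylog A a (real (inner_cols T))) \<and>
       real (baseconv_params T)
         \<le> N * log 2 (real c) * polylog A a (N * log 2 (real c)) \<and>
       computable_in_time N d (baseconv_apply T) t \<and>
       real t \<le> N * log 2 (real c) * polylog A a (N * log 2 (real c)) \<and>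
       real (length (layers T)) \<le> polylog A a (N * log 2 (real c)) \<and>
       (\<forall>x. (\<forall>i<N. x i \<in> C) \<longrightarrow>
          solves_mqar (emb ` C) (embed_tokens N d emb x) (baseconv_apply T (embed_tokens N d emb x))))"
proof -
  define \<kappa> where "\<kappa> = max K 1"
  define \<mu> where "\<mu> = 6 + log 2 \<kappa>"
  \<comment> \<open>20000 exceeds both 10752 = 7 * 24 * 64 from the parameters and 18433 = 12 * 24 *
    64 + 1 from the running time.\<close>
  define B where "B = 20000 * \<kappa> * \<mu>\<^sup>2"
  have km: "1 \<le> \<kappa>" "1 \<le> \<mu>" by (simp_all add: \<kappa>_def \<mu>_def)
  have mu2: "\<mu> \<le> \<mu>\<^sup>2" "1 \<le> \<mu>\<^sup>2" using km one_le_power[of \<mu> 2] by (simp_all add: power2_eq_square)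
  have kmu: "\<mu> \<le> \<kappa> * \<mu>\<^sup>2" "1 \<le> \<kappa> * \<mu>\<^sup>2" "\<kappa> * \<mu> \<le> \<kappa> * \<mu>\<^sup>2"
    using mult_mono[OF km(1) mu2(1)] mult_mono[OF km(1) mu2(2)] mult_left_mono[OF mu2(1), of \<kappa>] km by auto
  show ?thesis
  proof (intro exI[of _ B] exI[of _ 5] allI impI)
    fix N c d :: nat and C and emb :: "nat \<Rightarrow> real vec"
    assume N: "1 \<le> N" and C: "finite C" "card C = c" and c: "2 \<le> c" and d: "real d \<le> K * log 2 (real c)"
      and emb: "embedding C d emb"
    define Z where "Z = N * log 2 (real c)"
    define \<theta> where "\<theta> = 1 + log 2 Z"
    define P where "P = Suc (floor_log N)"
    define k0 where "k0 = Suc (floor_log (d + P))"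
    define M :: nat where "M = 2 ^ (k0 + 4)"
    note bounds = size_bounds[OF N c d, folded \<kappa>_def, folded Z_def P_def \<mu>_def, folded k0_def \<theta>_def, folded M_def]
    \<comment> \<open>Two distinct tokens cannot share the empty vector. A column is needed for the
      entry 2 to tell an output row from an embedded token.\<close>
    have "1 \<le> d"
    proof (rule ccontr)
      assume "\<not> 1 \<le> d"
      then have "emb y = emb z" if "y \<in> C" "z \<in> C" for y z
      proof -
        have "dim_vec (emb y) = d" "dim_vec (emb z) = d" using emb that by (auto simp: embedding_def)
        then show ?thesis using \<open>\<not> 1 \<le> d\<close> by (intro eq_vecI) auto
      qed
      note * = this
      obtain y where "y \<in> C" using C c by (metis all_not_in_conv card.empty not_numeral_le_zero)
      then have "emb ` C \<subseteq> {emb y}" using * by blast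
      then have "card (emb ` C) \<le> 1" using card_mono[of "{emb y}"] by simp
      then show False using emb C c by (simp add: embedding_def card_image)
    qed
    have NP: "N \<le> 2 ^ P" using floor_log_exp2_gt[of N] by (simp add: P_def)
    have dP: "d + P \<le> 2 ^ k0" using floor_log_exp2_gt[of "d + P"] by (simp add: k0_def)
    \<comment> \<open>So each position fits into the \<open>2 ^ k0\<close> bits of a field.\<close>
    then have "N \<le> 2 ^ 2 ^ k0"
      using NP power_increasing[of P "2 ^ k0" "2::nat"] by linarith
    then have "\<exists>e. (\<forall>l. e l \<in> {0, 1}) \<and> (i < N \<longrightarrow> block_val k0 e 0 = i)" for i
      using exists_block_val[of i k0] by (cases "i < N") (auto intro: exI[of _ "\<lambda>_. 0"])
    then obtain idx where idx: "\<And>i l. idx i l \<in> {0, 1}" "\<And>i. i < N \<Longrightarrow> block_val k0 (idx i) 0 = i"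
      by metis
    let ?steps = "mqar_steps N k0 P idx"
    define Ls where "Ls = map (compile N (k0 + 2)) ?steps"
    define T where "T = \<lparr>inner_rows = N, inner_cols = M, layers = Ls\<rparr>"
    let ?t = "1 + 12 * (N * M) * length Ls"
    have T: "inner_rows T = N" "inner_cols T = M" "layers T = Ls" by (simp_all add: T_def)
    have dM: "d \<le> M" using dP by (simp add: M_def power_add)
    have fl: "set Ls \<subseteq> flip_layers N (k0 + 4)"
      using compile_flip_layers[of _ "k0 + 2" N] exch_bit_mqar_steps[of N k0 P idx]
      by (auto simp: Ls_def numeral_eq_Suc)
    have L: "layer_wf N M L" "width L = 1" "expansion L = 1" if "L \<in> set Ls" for L
      using that fl flip_layer_wf unfolding M_def by (auto simp: flip_layers_def flip_layer_def)
    have len: "real (length Ls) \<le> 24 * \<mu> * \<theta> ^ 3"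
    proof -
      have "real (length Ls) \<le> real (4 * (P * P) * (6 * (k0 + 4)))"
        using length_mqar_steps[of P N k0 idx] unfolding of_nat_le_iff by (simp add: Ls_def P_def)
      also have "\<dots> = 24 * (real P * real P * real (k0 + 4))" by simp
      also have "\<dots> \<le> 24 * (\<theta> * \<theta> * (\<mu> * \<theta>))"
        using bounds by (intro mult_left_mono mult_mono) auto
      finally show ?thesis by (simp add: power3_eq_cube algebra_simps)
    qed
    have lpow: "\<theta> ^ i \<le> \<theta> ^ 5" if "i \<le> 5" for i using that bounds by (intro power_increasing) auto
    have lM: "real (length Ls) * real (N * M) \<le> 1536 * (\<kappa> * \<mu>) * (Z * \<theta> ^ 4)"
    proof -
      have "real (length Ls) * real (N * M) \<le> (24 * \<mu> * \<theta> ^ 3) * (64 * \<kappa> * Z * \<theta>)"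
        using len bounds km by (intro mult_mono) auto
      also have "\<dots> = 1536 * (\<kappa> * \<mu>) * (Z * \<theta> ^ 4)" by (simp add: power_def numeral_eq_Suc algebra_simps)
      finally show ?thesis .
    qed
    have "baseconv_wf N d T"
      using dM L by (simp add: baseconv_wf_def T)
    moreover have "real (width L) \<le> polylog B 5 (real (inner_cols T)) \<and>
        real (expansion L) \<le> polylog B 5 (real (inner_cols T))" if "L \<in> set (layers T)" for L
    proof -
      have "1 \<le> B" using kmu by (simp add: B_def)
      moreover have "1 \<le> (1 + log 2 (real M)) ^ 5" by (rule one_le_power) (simp add: M_def)
      ultimately have "1 \<le> B * (1 + log 2 (real M)) ^ 5" using mult_mono[of 1 B 1] by force
      then show ?thesis using L that by (simp add: T polylog_def)
    qed
    moreover have "real (baseconv_params T) \<le> Z * polylog B 5 Z"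
    proof -
      \<comment> \<open>Width and expansion are 1 and \<open>M = 2 ^ (k0 + 4)\<close>, so each of
        the two butterfly matrices has \<open>2 * M * (k0 + 4)\<close> parameters.\<close>
      have "layer_params N M L = 4 * M * (k0 + 4) + 3 * (N * M)" if "L \<in> set Ls" for L
        using L[OF that] by (simp add: layer_params_def butterfly_params_def M_def del: power_Suc)
      then have "baseconv_params T = length Ls * (4 * M * (k0 + 4) + 3 * (N * M))"
        by (simp add: baseconv_params_def T sum_list_triv cong: map_cong)
      also have "\<dots> \<le> length Ls * (4 * (N * M) * (k0 + 4) + 3 * (N * M))"
        using N by (intro mult_le_mono2 add_le_mono1 mult_le_mono1) auto
      finally have "real (baseconv_params T) \<le> real (length Ls * (4 * (N * M) * (k0 + 4) + 3 * (N * M)))"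
        unfolding of_nat_le_iff .
      also have "\<dots> = real (length Ls) * real (N * M) * (4 * real (k0 + 4) + 3)"
        by (simp add: algebra_simps)
      also have "\<dots> \<le> (1536 * (\<kappa> * \<mu>) * (Z * \<theta> ^ 4)) * (7 * (\<mu> * \<theta>))"
      proof (rule mult_mono[OF lM])
        have *: "4 * a + 3 \<le> 7 * b" if "a \<le> b" "1 \<le> b" for a b :: real using that by linarith
        have "1 \<le> \<mu> * \<theta>" using mult_mono[OF km(2) bounds(2)] km by simp
        then show "4 * real (k0 + 4) + 3 \<le> 7 * (\<mu> * \<theta>)" by (rule *[OF bounds(5)])
      qed (use km bounds in auto)
      also have "\<dots> = 10752 * (\<kappa> * \<mu>\<^sup>2 * (Z * \<theta> ^ 5))"
        by (simp add: power_def numeral_eq_Suc algebra_simps)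
      also have "\<dots> \<le> 20000 * (\<kappa> * \<mu>\<^sup>2 * (Z * \<theta> ^ 5))"
        using km bounds by (intro mult_right_mono) auto
      finally show ?thesis by (simp add: polylog_def B_def \<theta>_def algebra_simps)
    qed
    moreover have "computable_in_time N d (baseconv_apply T) ?t"
      unfolding M_def by (rule baseconv_computable) (use T fl N dM in \<open>auto simp: M_def\<close>)
    moreover have "real ?t \<le> Z * polylog B 5 Z"
    proof -
      have "real ?t = 1 + 12 * (real (length Ls) * real (N * M))" by simp
      also have "\<dots> \<le> 1 + 12 * (1536 * (\<kappa> * \<mu>) * (Z * \<theta> ^ 4))"
        by (intro add_left_mono mult_left_mono lM) simp
      also have "\<dots> = 1 + 18432 * ((\<kappa> * \<mu>) * (Z * \<theta> ^ 4))" by simp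
      also have "\<dots> \<le> (\<kappa> * \<mu>\<^sup>2) * (Z * \<theta> ^ 5) + 18432 * ((\<kappa> * \<mu>\<^sup>2) * (Z * \<theta> ^ 5))"
      proof (rule add_mono)
        have "1 \<le> Z * \<theta> ^ 5" using mult_mono[OF bounds(1) one_le_power[OF bounds(2), of 5]] bounds by simp
        then show "1 \<le> (\<kappa> * \<mu>\<^sup>2) * (Z * \<theta> ^ 5)" using mult_mono[OF kmu(2)] kmu by force
        show "18432 * ((\<kappa> * \<mu>) * (Z * \<theta> ^ 4)) \<le> 18432 * ((\<kappa> * \<mu>\<^sup>2) * (Z * \<theta> ^ 5))"
          using kmu lpow[of 4] bounds km by (intro mult_left_mono mult_mono) auto
      qed
      also have "\<dots> \<le> 20000 * ((\<kappa> * \<mu>\<^sup>2) * (Z * \<theta> ^ 5))"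
        using km bounds by simp
      finally show ?thesis by (simp add: polylog_def B_def \<theta>_def algebra_simps)
    qed
    moreover have "real (length (layers T)) \<le> polylog B 5 Z"
    proof -
      have "24 * \<mu> * \<theta> ^ 3 \<le> B * \<theta> ^ 5"
        using kmu lpow[of 3] bounds km unfolding B_def by (intro mult_mono) auto
      then show ?thesis using len by (simp add: T polylog_def \<theta>_def)
    qed
    moreover have "solves_mqar (emb ` C) (embed_tokens N d emb x) (baseconv_apply T (embed_tokens N d emb x))"
      if "\<forall>i<N. x i \<in> C" for x
      by (rule baseconv_apply_mqar[OF N NP \<open>1 \<le> d\<close> _ emb that idx])
        (use dP in \<open>auto simp: T_def M_def Ls_def\<close>)
    ultimately show "\<exists>T t. baseconv_wf N d T \<and>
       (\<forall>L\<in>set (layers T).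
          real (width L) \<le> polylog B 5 (real (inner_cols T)) \<and>
          real (expansion L) \<le> polylog B 5 (real (inner_cols T))) \<and>
       real (baseconv_params T)
         \<le> N * log 2 (real c) * polylog B 5 (N * log 2 (real c)) \<and>
       computable_in_time N d (baseconv_apply T) t \<and>
       real t \<le> N * log 2 (real c) * polylog B 5 (N * log 2 (real c)) \<and>
       real (length (layers T)) \<le> polylog B 5 (N * log 2 (real c)) \<and>
       (\<forall>x. (\<forall>i<N. x i \<in> C) \<longrightarrow>
          solves_mqar (emb ` C) (embed_tokens N d emb x) (baseconv_apply T (embed_tokens N d emb x)))"
      unfolding Z_def[symmetric] by (intro exI[of _ T] exI[of _ ?t]) blast
  qed
qed

end
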